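(* Let $D$ be a Dedekind domain, let $H$ be a subgroup of $SL_2(D)$, let $\mathcal{A}(H)$ be its set of cusp amplitudes, and let $$\mathfrak{c}_{\min}=\bigcap_{\mathfrak{q}\in\mathcal{A}(H)}\mathfrak{q}\qquad\text{and}\qquad \mathfrak{c}_{\max}=\sum_{\mathfrak{q}\in\mathcal{A}(H)}\mathfrak{q}.$$ If $H$ is a congruence subgroup, then $\mathfrak{c}_{\min}\in\mathcal{A}(H)$ and $\mathfrak{c}_{\max}\in\mathcal{A}(H)$. In particular, if $H$ is a congruence subgroup, there is an $H$-cusp in the $SL_2(D)$-orbit of $\infty$ whose cusp amplitude equals the level $l(H)$ of $H$.
   Context: Dedekind domains are integrally closed Noetherian domains of Krull dimension one (so not fields). Let $G=SL_2(D)$ and let $F$ be the quotient field of $D$. For $r\in D$ put $T(r)=\begin{pmatrix}1&r\\0&1\end{pmatrix}$. $G$ acts on $\mathbb{P}^1(F)=F\cup\{\infty\}$ by linear fractional transformations. For a subgroup $H\le G$, the $H$-cusps are the $H$-orbits on the $G$-orbit $G(\infty)$ of $\infty$. For $g\in G$, $\mathfrak{c}(H,g)$ denotes the largest ideal $\mathfrak{q}$ of $D$ such that $gT(q)g^{-1}\in H$ for all $q\in\mathfrak{q}$; it depends only on the $H$-cusp containing $g(\infty)$ and is called the cusp amplitude of that $H$-cusp. $\mathcal{A}(H)=\{\mathfrak{c}(H,g): g\in G\}$ is the set of cusp amplitudes of $H$. The level $l(H)$ is the largest ideal $\mathfrak{q}$ of $D$ such that $T(r)$ lies in every conjugate of $H$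 in $G$ for all $r\in\mathfrak{q}$. For an ideal $\mathfrak{q}$, $SL_2(D,\mathfrak{q})=\{X\in SL_2(D): X\equiv I_2 \pmod{\mathfrak{q}}\}$. $H$ is a congruence subgroup if $SL_2(D,\mathfrak{q})\le H$ for some non-zero ideal $\mathfrak{q}$ of $D$. *)

theory Defs
  imports
    "HOL-Analysis.Analysis"
    "HOL-Library.Extended_Nat"
    "HOL-Computational_Algebra.Polynomial_Factorial"
    "HOL-Algebra.Algebraic_Closure_Type"
    "HOL-Algebra.Ring_Divisibility"
    "HOL-Algebra.Group_Action"
begin

unbundle no fps_syntax

section \<open>Dedekind domains\<close>

abbreviation ideal_of :: "'a::comm_ring_1 set \<Rightarrow> bool" where
  "ideal_of I \<equiv> ideal I (ring_of_type_algebra :: 'a ring)"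

text \<open>A chain \<open>P 0 \<subset> P 1 \<subset> \<dots> \<subset> P n\<close> has length \<open>n\<close>, the number of strict inclusions.\<close>

definition krull_dim :: "('a, 'b) ring_scheme \<Rightarrow> enat" where
  "krull_dim R = Sup {enat n | n P. (\<forall>i\<le>n. primeideal (P i) R) \<and> (\<forall>i<n. P i \<subset> P (Suc i))}"

definition integrally_closed :: "'a::idom itself \<Rightarrow> bool" where
  "integrally_closed _ \<longleftrightarrow>
     (\<forall>x :: 'a fract. (\<exists>p :: 'a poly. Polynomial.lead_coeff p = 1 \<and> poly (map_poly to_fract p) x = 0)
        \<longrightarrow> x \<in> range to_fract)"

definition dedekind_domain :: "'a::idom itself \<Rightarrow> bool" where
  "dedekind_domain D \<longleftrightarrow>
     integrally_closed D \<and>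
     noetherian_domain (ring_of_type_algebra :: 'a ring) \<and>
     krull_dim (ring_of_type_algebra :: 'a ring) = 1"

text \<open>The sum of a possibly infinite family of ideals consists of the finite sums of elements.\<close>

definition ideal_sum :: "'a::comm_ring_1 set set \<Rightarrow> 'a set" where
  "ideal_sum \<A> = {\<Sum>I\<in>S. x I | S x. finite S \<and> S \<subseteq> \<A> \<and> (\<forall>I\<in>S. x I \<in> I)}"


section \<open>The group \<open>SL\<^sub>2\<close> and its action on the projective line\<close>

definition SL2 :: "('a::comm_ring_1^2^2) monoid" where
  "SL2 = \<lparr>carrier = {A. det A = 1}, monoid.mult = (**), one = mat 1\<rparr>"

definition T :: "'a::comm_ring_1 \<Rightarrow> 'a^2^2" where
  "T r = vector [vector [1, r], vector [0, 1]]"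

definition SL2_principal :: "'a::comm_ring_1 set \<Rightarrow> ('a^2^2) set" where
  "SL2_principal \<qq> = {A \<in> carrier SL2. \<forall>i j. A $ i $ j - mat 1 $ i $ j \<in> \<qq>}"

definition congruence_subgroup :: "('a::comm_ring_1^2^2) set \<Rightarrow> bool" where
  "congruence_subgroup H \<longleftrightarrow>
     subgroup H SL2 \<and> (\<exists>\<qq>. ideal_of \<qq> \<and> \<qq> \<noteq> {0} \<and> SL2_principal \<qq> \<subseteq> H)"

datatype 'f proj_line = Fin 'f | Infty

fun lin_frac :: "'a::idom^2^2 \<Rightarrow> 'a fract proj_line \<Rightarrow> 'a fract proj_line" where
  "lin_frac g Infty =
     (if g$2$1 = 0 then Infty else Fin (to_fract (g$1$1) / to_fract (g$2$1)))"
| "lin_frac g (Fin z) =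
     (if to_fract (g$2$1) * z + to_fract (g$2$2) = 0 then Infty
      else Fin ((to_fract (g$1$1) * z + to_fract (g$1$2)) /
                (to_fract (g$2$1) * z + to_fract (g$2$2))))"


section \<open>Cusps, cusp amplitudes and level\<close>

definition cusps :: "('a::idom^2^2) set \<Rightarrow> 'a fract proj_line set set" where
  "cusps H = orbits (SL2\<lparr>carrier := H\<rparr>) (orbit SL2 lin_frac Infty) lin_frac"

definition amplitude_at :: "('a::comm_ring_1^2^2) set \<Rightarrow> 'a^2^2 \<Rightarrow> 'a set" where
  "amplitude_at H g =
     (GREATEST \<qq>. ideal_of \<qq> \<and> (\<forall>q\<in>\<qq>. g \<otimes>\<^bsub>SL2\<^esub> T q \<otimes>\<^bsub>SL2\<^esub> inv\<^bsub>SL2\<^esub> g \<in> H))"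

definition amplitudes :: "('a::comm_ring_1^2^2) set \<Rightarrow> 'a set set" where
  "amplitudes H = amplitude_at H ` carrier SL2"

definition cusp_amplitude :: "('a::idom^2^2) set \<Rightarrow> 'a fract proj_line set \<Rightarrow> 'a set" where
  "cusp_amplitude H C =
     (THE \<qq>. \<exists>g\<in>carrier SL2. lin_frac g Infty \<in> C \<and> \<qq> = amplitude_at H g)"

definition level :: "('a::comm_ring_1^2^2) set \<Rightarrow> 'a set" where
  "level H =
     (GREATEST \<qq>. ideal_of \<qq> \<and>
        (\<forall>r\<in>\<qq>. \<forall>g\<in>carrier SL2. T r \<in> g <#\<^bsub>SL2\<^esub> H #>\<^bsub>SL2\<^esub> inv\<^bsub>SL2\<^esub> g))"

definition c_min :: "('a::comm_ring_1^2^2) set \<Rightarrow> 'a set" where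
  "c_min H = \<Inter>(amplitudes H)"

definition c_max :: "('a::comm_ring_1^2^2) set \<Rightarrow> 'a set" where
  "c_max H = ideal_sum (amplitudes H)"


section \<open>Well-definedness\<close>

text \<open>
  The largest ideal in the definition of \<open>amplitude_at\<close> exists, \<open>lin_frac\<close> is an action, and
  the amplitude at \<open>g\<close> depends only on the cusp containing \<open>g(\<infinity>)\<close>. The definite descriptions
  of amplitudes above therefore denote the intended ideals whenever \<open>H\<close> is a subgroup.
\<close>

lemma mult_SL2: "x \<otimes>\<^bsub>SL2\<^esub> y = x ** y" by (simp add: SL2_def)

lemma SL2_group: "group (SL2 :: ('a::comm_ring_1^2^2) monoid)"
proof (rule groupI)
  fix x :: "'a^2^2" assume x: "x \<in> carrier SL2"
  define y :: "'a^2^2" where "y = vector [vector [x$2$2, - x$1$2], vector [- x$2$1, x$1$1]]"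
  have "det y = 1" using x by (simp add: SL2_def det_2 y_def algebra_simps)
  moreover have "y ** x = mat 1" using x
    by (simp add: SL2_def det_2 y_def vec_eq_iff matrix_matrix_mult_def sum_2 forall_2 mat_def algebra_simps)
  ultimately show "\<exists>y\<in>carrier SL2. y \<otimes>\<^bsub>SL2\<^esub> x = \<one>\<^bsub>SL2\<^esub>" by (auto simp: SL2_def)
qed (auto simp: SL2_def det_mul matrix_mul_assoc det_I)

lemma inv_SL2: assumes x: "(x::'a::comm_ring_1^2^2) \<in> carrier SL2"
  shows "inv\<^bsub>SL2\<^esub> x = vector [vector [x$2$2, - x$1$2], vector [- x$2$1, x$1$1]]" (is "_ = ?y")
proof -
  have "det ?y = 1" using x by (simp add: SL2_def det_2 algebra_simps)
  moreover have "?y ** x = mat 1" using x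
    by (simp add: SL2_def det_2 vec_eq_iff matrix_matrix_mult_def sum_2 forall_2 mat_def algebra_simps)
  ultimately show ?thesis
    using x SL2_group by (intro group.inv_equality) (auto simp: SL2_def)
qed

lemma lin_frac_mult:
  assumes g: "(g::'a::idom^2^2) \<in> carrier SL2" and h: "h \<in> carrier SL2"
  shows "lin_frac (g \<otimes>\<^bsub>SL2\<^esub> h) z = lin_frac g (lin_frac h z)"
proof -
  define a b c d where "a = to_fract (g$1$1)" "b = to_fract (g$1$2)" "c = to_fract (g$2$1)" "d = to_fract (g$2$2)"
  define a' b' c' d' where "a' = to_fract (h$1$1)" "b' = to_fract (h$1$2)" "c' = to_fract (h$2$1)" "d' = to_fract (h$2$2)"
  note defs = a_b_c_d_def a'_b'_c'_d'_def
  have D: "a*d - b*c = 1" using g unfolding defs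
    by (simp add: SL2_def det_2 flip: to_fract_mult to_fract_diff to_fract_1)
  have D': "a'*d' - b'*c' = 1" using h unfolding defs
    by (simp add: SL2_def det_2 flip: to_fract_mult to_fract_diff to_fract_1)
  have M: "to_fract ((g**h)$1$1) = a*a'+b*c'" "to_fract ((g**h)$1$2) = a*b'+b*d'"
     "to_fract ((g**h)$2$1) = c*a'+d*c'" "to_fract ((g**h)$2$2) = c*b'+d*d'"
    by (simp_all add: defs matrix_matrix_mult_def sum_2)
  have Z: "to_fract y = 0 \<longleftrightarrow> y = 0" for y :: 'a by simp
  have mi: "lin_frac g (Fin z) = (if c * z + d = 0 then Infty else Fin ((a*z+b)/(c*z+d)))" for z by (simp add: defs)
  have mI: "lin_frac g Infty = (if c = 0 then Infty else Fin (a/c))" by (simp add: defs)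
  have cancel: "(if x = 0 then Infty else Fin (y / x)) = (if x/m = 0 then Infty else Fin ((y/m) / (x/m)))"
    if "m \<noteq> 0" for x y m :: "'a fract" using that by simp
  show ?thesis
  proof (cases z)
    case Infty
    have L: "lin_frac (g ** h) Infty = (if c*a'+d*c' = 0 then Infty else Fin ((a*a'+b*c')/(c*a'+d*c')))"
      by (simp only: lin_frac.simps M(1,3) Z[symmetric])
    have R: "lin_frac h Infty = (if c' = 0 then Infty else Fin (a'/c'))" by (simp add: defs)
    have n: "a' \<noteq> 0" if "c' = 0" using that D' by auto
    have "lin_frac (g ** h) Infty = lin_frac g (lin_frac h Infty)"
    proof (cases "c' = 0")
      case True then show ?thesis using n unfolding L R by (simp add: mI del: lin_frac.simps)
    next
      case False
      then have e: "c * (a'/c') + d = (c*a'+d*c')/c'" "a * (a'/c') + b = (a*a'+b*c')/c'" by (simp_all add: field_simps)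
      show ?thesis by (simp only: L R False if_False mi e) (rule cancel[OF False])
    qed
    then show ?thesis by (simp add: Infty SL2_def del: lin_frac.simps)
  next
    case (Fin w)
    let ?n = "a'*w+b'" and ?m = "c'*w+d'"
    have L: "lin_frac (g ** h) (Fin w) = (if c*?n+d*?m = 0 then Infty else Fin ((a*?n+b*?m)/(c*?n+d*?m)))"
      by (simp only: lin_frac.simps M) (simp add: algebra_simps)
    have R: "lin_frac h (Fin w) = (if ?m = 0 then Infty else Fin (?n/?m))" by (simp add: defs)
    have n: "?n \<noteq> 0" if "?m = 0"
    proof
      assume n0: "?n = 0"
      have "a' * ?m - c' * ?n = 1" using D' by (simp add: algebra_simps)
      then show False using that n0 by simp
    qed
    have "lin_frac (g ** h) (Fin w) = lin_frac g (lin_frac h (Fin w))"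
    proof (cases "?m = 0")
      case True then show ?thesis using n unfolding L R by (simp add: mI del: lin_frac.simps)
    next
      case False
      then have e: "c * (?n/?m) + d = (c*?n+d*?m)/?m" "a * (?n/?m) + b = (a*?n+b*?m)/?m"
        by (simp_all add: field_simps)
      show ?thesis by (simp only: L R False if_False mi e) (rule cancel[OF False])
    qed
    then show ?thesis by (simp add: Fin SL2_def del: lin_frac.simps)
  qed
qed

lemma ideal_iff: "ideal_of (I::'a::comm_ring_1 set) \<longleftrightarrow>
   0 \<in> I \<and> (\<forall>x\<in>I. \<forall>y\<in>I. x + y \<in> I) \<and> (\<forall>x\<in>I. \<forall>r. r * x \<in> I)"
proof
  assume "ideal_of I"
  then interpret ideal I "ring_of_type_algebra :: 'a ring" .
  show "0 \<in> I \<and> (\<forall>x\<in>I. \<forall>y\<in>I. x + y \<in> I) \<and> (\<forall>x\<in>I. \<forall>r. r * x \<in> I)"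
    using additive_subgroup.zero_closed[OF is_additive_subgroup] additive_subgroup.a_closed[OF is_additive_subgroup] I_l_closed
    by (auto simp: ring_of_type_algebra_def)
next
  assume *: "0 \<in> I \<and> (\<forall>x\<in>I. \<forall>y\<in>I. x + y \<in> I) \<and> (\<forall>x\<in>I. \<forall>r. r * x \<in> I)"
  have r: "ring (ring_of_type_algebra :: 'a ring)" ..
  interpret ring "ring_of_type_algebra :: 'a ring" by (rule r)
  have neg: "x \<in> I \<Longrightarrow> - x \<in> I" for x using *[THEN conjunct2, THEN conjunct2, rule_format, of x "-1"] by simp
  have ai: "inv\<^bsub>add_monoid ring_of_type_algebra\<^esub> x = - (x::'a)" for x
    by (rule group.inv_equality[OF a_group]) (auto simp: ring_of_type_algebra_def)
  show "ideal_of I"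
    using * neg ai
    by (intro idealI[OF r] group.subgroupI[OF a_group]) (auto simp: ring_of_type_algebra_def mult.commute)
qed

lemma T_add: "T (x + y) = T x \<otimes>\<^bsub>SL2\<^esub> T (y::'a::comm_ring_1)"
  by (simp add: T_def SL2_def vec_eq_iff matrix_matrix_mult_def sum_2 forall_2 add.commute)
lemma T_0: "T (0::'a::comm_ring_1) = \<one>\<^bsub>SL2\<^esub>"
  by (simp add: T_def SL2_def vec_eq_iff forall_2 mat_def)
lemma T_car: "T x \<in> carrier SL2" by (simp add: T_def SL2_def det_2)

lemma greatest_ideal:
  fixes S :: "'a::comm_ring_1 set"
  assumes "0 \<in> S" "\<And>x y. x \<in> S \<Longrightarrow> y \<in> S \<Longrightarrow> x + y \<in> S"
  shows "\<exists>J. ideal_of J \<and> J \<subseteq> S \<and> (\<forall>I. ideal_of I \<and> I \<subseteq> S \<longrightarrow> I \<subseteq> J)"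
proof -
  define J where "J = {x. \<forall>r. r * x \<in> S}"
  have "ideal_of J" using assms unfolding ideal_iff J_def
    by (auto simp: distrib_left mult.assoc[symmetric])
  moreover have "J \<subseteq> S" unfolding J_def using mult_1 by (metis (mono_tags) mem_Collect_eq subsetI)
  moreover have "I \<subseteq> J" if "ideal_of I" "I \<subseteq> S" for I
    using that unfolding ideal_iff J_def by blast
  ultimately show ?thesis by blast
qed

lemma amplitude_at_greatest:
  fixes H :: "('a::comm_ring_1^2^2) set"
  assumes H: "subgroup H SL2" and g: "g \<in> carrier SL2"
  defines "P \<equiv> \<lambda>q. ideal_of q \<and> (\<forall>x\<in>q. g \<otimes>\<^bsub>SL2\<^esub> T x \<otimes>\<^bsub>SL2\<^esub> inv\<^bsub>SL2\<^esub> g \<in> H)"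
  shows "P (amplitude_at H g)" "\<And>I. P I \<Longrightarrow> I \<subseteq> amplitude_at H g"
proof -
  interpret group "SL2 :: ('a^2^2) monoid" by (rule SL2_group)
  define S where "S = {x. g \<otimes>\<^bsub>SL2\<^esub> T x \<otimes>\<^bsub>SL2\<^esub> inv\<^bsub>SL2\<^esub> g \<in> H}"
  have cancel: "inv\<^bsub>SL2\<^esub> g \<otimes>\<^bsub>SL2\<^esub> (g \<otimes>\<^bsub>SL2\<^esub> z) = z" if "z \<in> carrier SL2" for z
    using g that by (simp flip: m_assoc)
  have zero: "0 \<in> S" using g subgroup.one_closed[OF H] by (simp add: S_def T_0)
  have add: "x + y \<in> S" if "x \<in> S" "y \<in> S" for x y
  proof -
    have "(g \<otimes>\<^bsub>SL2\<^esub> T x \<otimes>\<^bsub>SL2\<^esub> inv\<^bsub>SL2\<^esub> g) \<otimes>\<^bsub>SL2\<^esub> (g \<otimes>\<^bsub>SL2\<^esub> T y \<otimes>\<^bsub>SL2\<^esub> inv\<^bsub>SL2\<^esub> g) \<in> H"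
      using that subgroup.m_closed[OF H] by (auto simp: S_def)
    also have "(g \<otimes>\<^bsub>SL2\<^esub> T x \<otimes>\<^bsub>SL2\<^esub> inv\<^bsub>SL2\<^esub> g) \<otimes>\<^bsub>SL2\<^esub> (g \<otimes>\<^bsub>SL2\<^esub> T y \<otimes>\<^bsub>SL2\<^esub> inv\<^bsub>SL2\<^esub> g)
       = g \<otimes>\<^bsub>SL2\<^esub> T (x + y) \<otimes>\<^bsub>SL2\<^esub> inv\<^bsub>SL2\<^esub> g"
      using g cancel by (simp add: m_assoc T_add T_car)
    finally show ?thesis by (simp add: S_def)
  qed
  obtain J where J: "ideal_of J \<and> J \<subseteq> S \<and> (\<forall>I. ideal_of I \<and> I \<subseteq> S \<longrightarrow> I \<subseteq> J)"
    using greatest_ideal[OF zero add] by (rule exE)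
  have P_iff: "P I \<longleftrightarrow> ideal_of I \<and> I \<subseteq> S" for I
    unfolding P_def S_def by (simp add: subset_eq)
  have PJ: "P J" using J unfolding P_iff by simp
  have max: "I \<subseteq> J" if "P I" for I using J that unfolding P_iff by simp
  have "amplitude_at H g = J"
    unfolding amplitude_at_def P_def[symmetric] using PJ max by (intro Greatest_equality)
  then show "P (amplitude_at H g)" "\<And>I. P I \<Longrightarrow> I \<subseteq> amplitude_at H g"
    using PJ max by simp_all
qed

lemma cusp_amplitude_eq:
  fixes H :: "('a::idom^2^2) set"
  assumes H: "subgroup H SL2" and C: "C \<in> cusps H" and g: "g \<in> carrier SL2" "lin_frac g Infty \<in> C"
  shows "cusp_amplitude H C = amplitude_at H g"
proof -
  interpret group "SL2 :: ('a^2^2) monoid" by (rule SL2_group)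
  have key: "amplitude_at H k \<subseteq> amplitude_at H g"
    if k: "k \<in> carrier SL2" "lin_frac k Infty \<in> C" and g: "g \<in> carrier SL2" "lin_frac g Infty \<in> C" for k g
  proof -
    obtain z where C: "C = {lin_frac h z | h. h \<in> H}" using \<open>C \<in> cusps H\<close>
      by (auto simp: cusps_def orbits_def orbit_def)
    have Hc: "h \<in> carrier SL2" if "h \<in> H" for h using that subgroup.mem_carrier[OF H] by auto
    obtain h1 h2 where h: "h1 \<in> H" "lin_frac k Infty = lin_frac h1 z" "h2 \<in> H" "lin_frac g Infty = lin_frac h2 z"
      using k g unfolding C by auto
    define h where "h = h1 \<otimes>\<^bsub>SL2\<^esub> inv\<^bsub>SL2\<^esub> h2"
    have hH: "h \<in> H" unfolding h_def using h H by (simp add: subgroup.m_closed subgroup.m_inv_closed)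
    have hc: "h \<in> carrier SL2" using Hc hH .
    define k' where "k' = inv\<^bsub>SL2\<^esub> h \<otimes>\<^bsub>SL2\<^esub> k"
    have k': "k' \<in> carrier SL2" using hc k by (simp add: k'_def)
    have ke: "k = h \<otimes>\<^bsub>SL2\<^esub> k'" using hc k unfolding k'_def by (simp flip: m_assoc)
    have ih: "inv\<^bsub>SL2\<^esub> h = h2 \<otimes>\<^bsub>SL2\<^esub> inv\<^bsub>SL2\<^esub> h1" using Hc h by (simp add: h_def inv_mult_group)
    have "lin_frac k' Infty = lin_frac (h2 \<otimes>\<^bsub>SL2\<^esub> inv\<^bsub>SL2\<^esub> h1) (lin_frac h1 z)"
      unfolding k'_def ih using k Hc h by (subst lin_frac_mult) (simp_all del: lin_frac.simps)
    also have "\<dots> = lin_frac (h2 \<otimes>\<^bsub>SL2\<^esub> inv\<^bsub>SL2\<^esub> h1 \<otimes>\<^bsub>SL2\<^esub> h1) z" using Hc h by (simp add: lin_frac_mult)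
    also have "\<dots> = lin_frac g Infty" using Hc h by (simp add: m_assoc del: lin_frac.simps)
    finally have eq: "lin_frac k' Infty = lin_frac g Infty" .
    have "to_fract (k'$1$1 * g$2$1) = to_fract (k'$2$1 * g$1$1)"
      using eq by (auto split: if_splits simp: frac_eq_eq)
    then have col: "k'$1$1 * g$2$1 = k'$2$1 * g$1$1" by (simp del: to_fract_mult)
    define s where "s = inv\<^bsub>SL2\<^esub> k' \<otimes>\<^bsub>SL2\<^esub> g"
    have s: "s \<in> carrier SL2" using k' g by (simp add: s_def)
    have s21: "s$2$1 = 0" using col k' by (simp add: s_def inv_SL2 mult_SL2 matrix_matrix_mult_def sum_2)
    have s11: "s$1$1 * s$2$2 = 1" using s s21 by (simp add: SL2_def det_2)
    have gs: "g = k' \<otimes>\<^bsub>SL2\<^esub> s" using k' g unfolding s_def by (simp flip: m_assoc)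
    have sT: "s \<otimes>\<^bsub>SL2\<^esub> T q \<otimes>\<^bsub>SL2\<^esub> inv\<^bsub>SL2\<^esub> s = T (s$1$1 * s$1$1 * q)" for q
      unfolding inv_SL2[OF s] using s11 s21
      by (simp add: T_def SL2_def matrix_matrix_mult_def sum_2 vec_eq_iff forall_2 algebra_simps)
    have gT: "g \<otimes>\<^bsub>SL2\<^esub> T q \<otimes>\<^bsub>SL2\<^esub> inv\<^bsub>SL2\<^esub> g = inv\<^bsub>SL2\<^esub> h \<otimes>\<^bsub>SL2\<^esub> (k \<otimes>\<^bsub>SL2\<^esub> T (s$1$1 * s$1$1 * q) \<otimes>\<^bsub>SL2\<^esub> inv\<^bsub>SL2\<^esub> k) \<otimes>\<^bsub>SL2\<^esub> h" for q
    proof -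
      have "g \<otimes>\<^bsub>SL2\<^esub> T q \<otimes>\<^bsub>SL2\<^esub> inv\<^bsub>SL2\<^esub> g = k' \<otimes>\<^bsub>SL2\<^esub> (s \<otimes>\<^bsub>SL2\<^esub> T q \<otimes>\<^bsub>SL2\<^esub> inv\<^bsub>SL2\<^esub> s) \<otimes>\<^bsub>SL2\<^esub> inv\<^bsub>SL2\<^esub> k'"
        using k' s unfolding gs by (simp add: inv_mult_group m_assoc T_car)
      also have "\<dots> = inv\<^bsub>SL2\<^esub> h \<otimes>\<^bsub>SL2\<^esub> (k \<otimes>\<^bsub>SL2\<^esub> T (s$1$1 * s$1$1 * q) \<otimes>\<^bsub>SL2\<^esub> inv\<^bsub>SL2\<^esub> k) \<otimes>\<^bsub>SL2\<^esub> h"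
        unfolding sT k'_def using k hc by (simp add: inv_mult_group m_assoc T_car)
      finally show ?thesis .
    qed
    have gH: "g \<otimes>\<^bsub>SL2\<^esub> T q \<otimes>\<^bsub>SL2\<^esub> inv\<^bsub>SL2\<^esub> g \<in> H" if "q \<in> amplitude_at H k" for q
    proof -
      have "s$1$1 * s$1$1 * q \<in> amplitude_at H k"
        using amplitude_at_greatest(1)[OF H k(1)] that by (simp add: ideal_iff)
      then have "k \<otimes>\<^bsub>SL2\<^esub> T (s$1$1 * s$1$1 * q) \<otimes>\<^bsub>SL2\<^esub> inv\<^bsub>SL2\<^esub> k \<in> H"
        using amplitude_at_greatest(1)[OF H k(1)] by blast
      then show ?thesis
        unfolding gT
        by (rule subgroup.m_closed[OF H subgroup.m_closed[OF H subgroup.m_inv_closed[OF H hH]] hH])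
    qed
    show ?thesis
      by (rule amplitude_at_greatest(2)[OF H g(1)])
        (use amplitude_at_greatest(1)[OF H k(1)] gH in simp)
  qed
  show ?thesis unfolding cusp_amplitude_def
  proof (rule the_equality)
    show "\<exists>g'\<in>carrier SL2. lin_frac g' Infty \<in> C \<and> amplitude_at H g = amplitude_at H g'"
      using g by blast
    show "\<qq> = amplitude_at H g"
      if "\<exists>g'\<in>carrier SL2. lin_frac g' Infty \<in> C \<and> \<qq> = amplitude_at H g'" for \<qq>
      using that key g by (metis subset_antisym)
  qed
qed

end

theory Submission
  imports Defs
begin

unbundle no Formal_Power_Series.fps_syntax

text \<open>
  Let \<open>SL\<^sub>2(D, q) \<le> H\<close> with \<open>q \<noteq> 0\<close>. Every amplitude \<open>c(g)\<close> contains \<open>q\<close>, so it is the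
  intersection of its \<open>M\<close>-primary parts over the finitely many maximal ideals \<open>M\<close> above \<open>q\<close>.
  If \<open>x \<in> c(g)\<close> lies in the \<open>N\<close>-primary part of \<open>q\<close> for all \<open>N \<noteq> M\<close>, then \<open>g T(x) g\<inverse>\<close> is trivial
  modulo these parts, so it depends modulo \<open>q\<close> only on \<open>g\<close> modulo the \<open>M\<close>-primary part of \<open>q\<close>.
  Hence so does the \<open>M\<close>-part of \<open>c(g)\<close>. In a Dedekind domain the \<open>M\<close>-parts of ideals above \<open>q\<close> form
  a finite chain, so a least (greatest) \<open>M\<close>-part is attained by some \<open>g\<^sub>M\<close>. As \<open>D\<close> modulo a primary
  part is local, its \<open>SL\<^sub>2\<close> is generated by elementary matrices, which lift; so the \<open>g\<^sub>M\<close> can be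
  glued to one \<open>g\<close>, whose amplitude is least (greatest) at all \<open>M\<close> simultaneously.
\<close>

section \<open>Ideals and chain conditions\<close>

abbreviation prime_ideal_of :: "'a::comm_ring_1 set \<Rightarrow> bool" where
  "prime_ideal_of P \<equiv> primeideal P (ring_of_type_algebra :: 'a ring)"

abbreviation maximal_ideal_of :: "'a::comm_ring_1 set \<Rightarrow> bool" where
  "maximal_ideal_of M \<equiv> maximalideal M (ring_of_type_algebra :: 'a ring)"

lemma carrier_ring_of_type [simp]: "carrier (ring_of_type_algebra :: 'a::ring_1 ring) = UNIV"
  by (simp add: ring_of_type_algebra_def)

lemma ideal_zero: "ideal_of I \<Longrightarrow> 0 \<in> I"
  and ideal_add: "ideal_of I \<Longrightarrow> x \<in> I \<Longrightarrow> y \<in> I \<Longrightarrow> x + y \<in> I"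
  and ideal_mult_left: "ideal_of I \<Longrightarrow> x \<in> I \<Longrightarrow> r * x \<in> I"
  and ideal_mult_right: "ideal_of I \<Longrightarrow> x \<in> I \<Longrightarrow> x * r \<in> I"
  for I :: "'a::comm_ring_1 set"
  by (auto simp: ideal_iff mult.commute[of x r])

lemma ideal_uminus: "ideal_of I \<Longrightarrow> x \<in> I \<Longrightarrow> - x \<in> I"
  and ideal_diff: "ideal_of I \<Longrightarrow> x \<in> I \<Longrightarrow> y \<in> I \<Longrightarrow> x - y \<in> I"
  for I :: "'a::comm_ring_1 set"
  using ideal_mult_left[of I x "-1"] ideal_mult_left[of I y "-1"] ideal_add[of I x "- y"] by simp_all

lemma ideal_sum_closed: "ideal_of I \<Longrightarrow> (\<And>i. i \<in> S \<Longrightarrow> f i \<in> I) \<Longrightarrow> sum f S \<in> I"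
  for I :: "'a::comm_ring_1 set"
  by (induction S rule: infinite_finite_induct) (simp_all add: ideal_zero ideal_add)

lemma ideal_one_iff: "ideal_of I \<Longrightarrow> 1 \<in> I \<longleftrightarrow> I = UNIV" for I :: "'a::comm_ring_1 set"
  using ideal_mult_left[of I 1] by auto

text \<open>The set is the ideal generated by \<open>I\<close> and \<open>s\<close>.\<close>

lemma ideal_principal_plus:
  fixes I :: "'a::comm_ring_1 set"
  assumes I: "ideal_of I"
  shows "ideal_of {d * s + z | d z. z \<in> I}" (is "ideal_of ?J")
  unfolding ideal_iff
proof (intro conjI ballI allI)
  show "0 \<in> ?J" using ideal_zero[OF I] by (intro CollectI exI[of _ 0]) auto
next
  fix x y assume "x \<in> ?J" "y \<in> ?J"
  then obtain d1 z1 d2 z2 where "x = d1 * s + z1" "y = d2 * s + z2" "z1 \<in> I" "z2 \<in> I" by blast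
  then have "x + y = (d1 + d2) * s + (z1 + z2)" "z1 + z2 \<in> I"
    using ideal_add[OF I] by (simp_all add: algebra_simps)
  then show "x + y \<in> ?J" by blast
next
  fix x r assume "x \<in> ?J"
  then obtain d z where "x = d * s + z" "z \<in> I" by blast
  then have "r * x = (r * d) * s + r * z" "r * z \<in> I"
    using ideal_mult_left[OF I, of z r] by (simp_all add: distrib_left mult.assoc)
  then show "r * x \<in> ?J" by blast
qed

lemma ideal_colon: "ideal_of I \<Longrightarrow> ideal_of {d. d * z \<in> I}" for I :: "'a::comm_ring_1 set"
  by (simp add: ideal_iff distrib_right mult.assoc)

lemma prime_ideal_iff:
  "prime_ideal_of P \<longleftrightarrow> ideal_of P \<and> 1 \<notin> P \<and> (\<forall>x y. x * y \<in> P \<longrightarrow> x \<in> P \<or> y \<in> P)"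
  for P :: "'a::comm_ring_1 set"
proof -
  have m: "x \<otimes>\<^bsub>ring_of_type_algebra\<^esub> y = x * y" for x y :: 'a
    by (simp add: ring_of_type_algebra_def)
  have "ideal_of P \<Longrightarrow> UNIV \<noteq> P \<longleftrightarrow> 1 \<notin> P"
    by (simp add: ideal_one_iff eq_commute)
  then show ?thesis
    by (simp add: primeideal_def primeideal_axioms_def m cring_from_type_algebra cong: conj_cong)
qed

lemma maximal_ideal_iff:
  "maximal_ideal_of M \<longleftrightarrow> ideal_of M \<and> 1 \<notin> M \<and> (\<forall>I. ideal_of I \<and> M \<subseteq> I \<and> 1 \<notin> I \<longrightarrow> I = M)"
  for M :: "'a::comm_ring_1 set"
proof -
  have *: "ideal_of I \<Longrightarrow> I = UNIV \<longleftrightarrow> 1 \<in> I" for I :: "'a set"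
    by (simp add: ideal_one_iff)
  have "maximal_ideal_of M \<longleftrightarrow>
      ideal_of M \<and> M \<noteq> UNIV \<and> (\<forall>I. ideal_of I \<and> M \<subseteq> I \<longrightarrow> I = M \<or> I = UNIV)"
    by (auto simp: maximalideal_def maximalideal_axioms_def)
  also have "\<dots> \<longleftrightarrow> ideal_of M \<and> 1 \<notin> M \<and> (\<forall>I. ideal_of I \<and> M \<subseteq> I \<and> 1 \<notin> I \<longrightarrow> I = M)"
    by (intro conj_cong all_cong refl) (use * in auto)
  finally show ?thesis .
qed

lemma maximal_ideal_prime: "maximal_ideal_of M \<Longrightarrow> prime_ideal_of M" for M :: "'a::comm_ring_1 set"
  by (rule cring.maximalideal_prime[OF cring_from_type_algebra])

lemma prime_ideal_power: "prime_ideal_of P \<Longrightarrow> x ^ n \<in> P \<Longrightarrow> x \<in> P" for P :: "'a::comm_ring_1 set"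
  by (induction n) (auto simp: prime_ideal_iff)

section \<open>Chain conditions and maximal ideals in a Dedekind domain\<close>

locale dedekind =
  fixes ty :: "'a::idom itself"
  assumes dedekind: "dedekind_domain TYPE('a)"
begin

text \<open>Zorn's lemma applies because in a Noetherian ring the union of a nonempty chain of
  ideals is a member of the chain.\<close>

lemma maximal_element:
  fixes \<F> :: "'a set set"
  assumes "\<F> \<noteq> {}" "\<And>I. I \<in> \<F> \<Longrightarrow> ideal_of I"
  obtains J where "J \<in> \<F>" "\<And>I. I \<in> \<F> \<Longrightarrow> J \<subseteq> I \<Longrightarrow> I = J"
proof -
  interpret noetherian_domain "ring_of_type_algebra :: 'a ring"
    using dedekind by (simp add: dedekind_domain_def)
  have "\<exists>M\<in>\<F>. \<forall>I\<in>\<F>. M \<subseteq> I \<longrightarrow> I = M"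
  proof (rule subset_Zorn_nonempty[OF assms(1)])
    fix C assume C: "C \<noteq> {}" "subset.chain \<F> C"
    then have "subset.chain {I. ideal_of I} C"
      using assms(2) by (auto simp: subset.chain_def)
    then show "\<Union> C \<in> \<F>"
      using ideal_chain_is_trivial[of C] C by (auto simp: subset.chain_def)
  qed
  then show thesis using that by blast
qed

text \<open>The induction runs downwards from larger ideals: a counterexample maximal among all
  ideals contradicts the second assumption.\<close>

lemma noetherian_induct [consumes 1, case_names less]:
  fixes I :: "'a set"
  assumes "ideal_of I"
    and "\<And>I. ideal_of I \<Longrightarrow> (\<And>J. ideal_of J \<Longrightarrow> I \<subset> J \<Longrightarrow> P J) \<Longrightarrow> P I"
  shows "P I"
proof (rule ccontr)
  assume "\<not> P I"
  then obtain J where "J \<in> {J. ideal_of J \<and> \<not> P J}"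
    "\<And>I. I \<in> {J. ideal_of J \<and> \<not> P J} \<Longrightarrow> J \<subseteq> I \<Longrightarrow> I = J"
    using maximal_element[of "{J. ideal_of J \<and> \<not> P J}"] assms(1) by blast
  then show False using assms(2)[of J] by blast
qed

lemma ascending_chain_stabilizes:
  fixes I :: "nat \<Rightarrow> 'a set"
  assumes "\<And>n. ideal_of (I n)" "\<And>n. I n \<subseteq> I (Suc n)"
  obtains n where "I (Suc n) = I n"
proof -
  obtain J where J: "J \<in> range I" "\<And>K. K \<in> range I \<Longrightarrow> J \<subseteq> K \<Longrightarrow> K = J"
    using maximal_element[of "range I"] assms(1) by blast
  then obtain n where n: "J = I n" by auto
  show thesis using J(2)[of "I (Suc n)"] assms(2)[of n] by (intro that[of n]) (simp add: n)
qed

lemma maximal_ideal_above: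
  fixes I :: "'a set"
  assumes "ideal_of I" "1 \<notin> I"
  obtains M where "maximal_ideal_of M" "I \<subseteq> M"
proof -
  let ?F = "{J. ideal_of J \<and> I \<subseteq> J \<and> 1 \<notin> J}"
  obtain M where M: "M \<in> ?F" "\<And>J. J \<in> ?F \<Longrightarrow> M \<subseteq> J \<Longrightarrow> J = M"
    using maximal_element[of ?F] assms by blast
  have "J = M" if "ideal_of J" "M \<subseteq> J" "1 \<notin> J" for J
    using M(1) that by (intro M(2)) auto
  then have "maximal_ideal_of M" unfolding maximal_ideal_iff using M(1) by simp
  then show thesis using that M(1) by simp
qed

text \<open>A maximal ideal \<open>M\<close> strictly above \<open>P\<close> would give the chain
  \<open>{0}\<close>, \<open>P\<close>, \<open>M\<close> of length two, against Krull dimension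
  one.\<close>

lemma prime_imp_maximal:
  fixes P :: "'a set"
  assumes P: "prime_ideal_of P" "P \<noteq> {0}"
  shows "maximal_ideal_of P"
proof (rule ccontr)
  assume not_max: "\<not> maximal_ideal_of P"
  obtain M where M: "maximal_ideal_of M" "P \<subseteq> M"
    using P maximal_ideal_above[of P] by (auto simp: prime_ideal_iff)
  define Q where "Q i = (if i = 0 then {0} else if i = 1 then P else M)" for i :: nat
  have "P \<subset> M" using M not_max by auto
  moreover have "{0} \<subset> P" using P ideal_zero[of P] by (auto simp: prime_ideal_iff)
  moreover have "prime_ideal_of ({0} :: 'a set)" by (auto simp: prime_ideal_iff ideal_iff)
  ultimately have "(\<forall>i\<le>2. prime_ideal_of (Q i)) \<and> (\<forall>i<2. Q i \<subset> Q (Suc i))"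
    using P maximal_ideal_prime[OF M(1)] by (auto simp: Q_def less_2_cases_iff)
  then have "enat 2 \<le> krull_dim (ring_of_type_algebra :: 'a ring)"
    unfolding krull_dim_def by (intro Sup_upper) blast
  then show False
    using dedekind by (simp add: dedekind_domain_def one_enat_def)
qed

text \<open>If \<open>x * y\<close> lies in \<open>I\<close> but \<open>x\<close> and
  \<open>y\<close> do not, every maximal ideal above \<open>I\<close> contains one of the strictly
  larger ideals \<open>I + (x)\<close> and \<open>I + (y)\<close>, and Noetherian induction applies
  to both.\<close>

lemma finite_maximal_ideals_above:
  fixes I :: "'a set"
  assumes "ideal_of I" "I \<noteq> {0}"
  shows "finite {M. maximal_ideal_of M \<and> I \<subseteq> M}"
  using assms
proof (induction rule: noetherian_induct)
  case (less I)
  have "I \<noteq> {}" using ideal_zero[OF less(1)] by auto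
  consider "1 \<in> I" | "prime_ideal_of I" | x y where "x * y \<in> I" "x \<notin> I" "y \<notin> I"
    using less(1) by (auto simp: prime_ideal_iff)
  then show ?case
  proof cases
    case 1
    then have "{M. maximal_ideal_of M \<and> I \<subseteq> M} = {}" by (auto simp: maximal_ideal_iff)
    then show ?thesis by (simp only: finite.emptyI)
  next
    case 2
    then have "maximal_ideal_of I" using less.prems prime_imp_maximal by blast
    then have "{M. maximal_ideal_of M \<and> I \<subseteq> M} \<subseteq> {I}" by (auto simp: maximal_ideal_iff)
    then show ?thesis by (rule finite_subset) simp
  next
    case (3 x y)
    define J where "J s = {d * s + z | d z. z \<in> I}" for s
    have sub: "I \<subseteq> J s" for s unfolding J_def by (force intro: exI[of _ 0])
    have mem: "s \<in> J s" for s
      unfolding J_def using ideal_zero[OF less(1)] by (force intro: exI[of _ 1])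
    have fin: "finite {M. maximal_ideal_of M \<and> J s \<subseteq> M}" if "s \<notin> I" for s
    proof (rule less.IH)
      show "ideal_of (J s)" unfolding J_def by (rule ideal_principal_plus[OF less(1)])
      show "I \<subset> J s" using sub mem that by blast
      show "J s \<noteq> {0}" using sub[of s] less.prems \<open>I \<noteq> {}\<close> by auto
    qed
    have "J x \<subseteq> M \<or> J y \<subseteq> M" if M: "maximal_ideal_of M" "I \<subseteq> M" for M
    proof -
      have P: "ideal_of M" "x \<in> M \<or> y \<in> M"
        using maximal_ideal_prime[OF M(1)] M(2) 3 by (auto simp: prime_ideal_iff)
      then show ?thesis
        using M(2) unfolding J_def by (auto intro!: ideal_add[OF P(1)] ideal_mult_left[OF P(1)])
    qed
    then have "{M. maximal_ideal_of M \<and> I \<subseteq> M}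
        \<subseteq> {M. maximal_ideal_of M \<and> J x \<subseteq> M} \<union> {M. maximal_ideal_of M \<and> J y \<subseteq> M}" by blast
    then show ?thesis using fin 3 by (meson finite_UnI finite_subset)
  qed
qed

end

section \<open>Uniformizers\<close>

context dedekind
begin

text \<open>
  For \<open>x = b / a\<close> this says that \<open>M\<close> is the set of all \<open>d\<close> with \<open>d x \<in> D\<close>. The proof takes \<open>b\<close> such
  that \<open>{d. a dvd d * b}\<close> is maximal among the sets of this form inside \<open>M\<close>.
\<close>

lemma prime_annihilator:
  fixes M :: "'a set"
  assumes M: "maximal_ideal_of M" and a: "a \<in> M" "a \<noteq> 0"
  obtains b where "\<And>d. a dvd d * b \<longleftrightarrow> d \<in> M"
proof -
  define A where "A b = {d. a dvd d * b}" for b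
  have idl: "ideal_of (A b)" for b
    by (auto simp: A_def ideal_iff distrib_right mult.assoc)
  have "A 1 \<subseteq> M"
    using ideal_mult_right[of M a] M a by (auto simp: A_def dvd_def maximal_ideal_iff)
  then have "{A b | b. A b \<subseteq> M} \<noteq> {}" by blast
  then obtain N where N: "N \<in> {A b | b. A b \<subseteq> M}"
    "\<And>I. I \<in> {A b | b. A b \<subseteq> M} \<Longrightarrow> N \<subseteq> I \<Longrightarrow> I = N"
    by (rule maximal_element) (use idl in auto)
  then obtain b where b: "N = A b" "A b \<subseteq> M" by blast
  have above: "A (x * b) = A b" if "A (x * b) \<subseteq> M" for x
  proof -
    have "A b \<subseteq> A (x * b)" by (auto simp: A_def mult.left_commute[of _ x])
    then show ?thesis using N(2)[of "A (x * b)"] that b(1) by blast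
  qed
  \<comment> \<open>Primality of \<open>M\<close> keeps \<open>A (s * b)\<close> inside
    \<open>M\<close>, so maximality of \<open>A b\<close> forces equality.\<close>
  have unit: "A (s * b) = A b" if "s \<notin> M" for s
  proof (rule above, rule subsetI)
    fix d assume "d \<in> A (s * b)"
    then have "d * s \<in> M" using b by (auto simp: A_def mult.assoc)
    then show "d \<in> M" using maximal_ideal_prime[OF M] that by (auto simp: prime_ideal_iff)
  qed
  have "prime_ideal_of (A b)"
    unfolding prime_ideal_iff
  proof (intro conjI idl allI impI)
    show "1 \<notin> A b" using b M by (auto simp: maximal_ideal_iff)
    fix x y assume xy: "x * y \<in> A b"
    show "x \<in> A b \<or> y \<in> A b"
    proof (rule disjCI)
      assume y: "y \<notin> A b"
      have "y \<in> A (x * b)" using xy by (simp add: A_def mult_ac)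
      \<comment> \<open>If \<open>A (x * b)\<close> were inside \<open>M\<close>, it would equal
        \<open>A b\<close>, which misses \<open>y\<close>.\<close>
      then obtain s where s: "s \<in> A (x * b)" "s \<notin> M" using above[of x] y by auto
      then have "x \<in> A (s * b)" by (simp add: A_def mult_ac)
      then show "x \<in> A b" using unit s by simp
    qed
  qed
  moreover have "a \<in> A b" by (simp add: A_def)
  ultimately have "maximal_ideal_of (A b)" using a by (intro prime_imp_maximal) auto
  then have "M = A b" using M b unfolding maximal_ideal_iff by blast
  then show thesis by (intro that[of b]) (simp add: A_def)
qed

text \<open>Here \<open>c n = a x\<^sup>n\<close> for \<open>x = b / a\<close>, and \<open>rel\<close> is an integral equation for \<open>x\<close>.\<close>

lemma integral_imp_dvd:
  fixes a b :: 'a and c d :: "nat \<Rightarrow> 'a"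
  assumes a: "a \<noteq> 0" and c: "c 0 = a" "\<And>n. b * c n = a * c (Suc n)"
    and rel: "c (Suc n) = (\<Sum>i\<le>n. d i * c i)"
  shows "a dvd b"
proof -
  define x where "x = to_fract b / to_fract a"
  have a': "to_fract a \<noteq> 0" using a by simp
  have cx: "to_fract (c i) = to_fract a * x ^ i" for i
  proof (induction i)
    case (Suc i)
    have "to_fract a * to_fract (c (Suc i)) = to_fract b * to_fract (c i)"
      using c(2)[of i] by (simp flip: to_fract_mult)
    also have "\<dots> = to_fract a * (to_fract a * x ^ Suc i)"
      using a' by (simp add: Suc x_def)
    finally show ?case using a' by simp
  qed (simp add: c)
  \<comment> \<open>The monic polynomial \<open>X^(n+1) - (d n X^n + ... + d 0)\<close>; its value
    at \<open>x\<close>, multiplied by \<open>a\<close>, vanishes by \<open>rel\<close>.\<close>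
  define p where "p = Poly (map (\<lambda>i. - d i) [0..<Suc n] @ [1])"
  have cp: "poly.coeff p i = (if i \<le> n then - d i else if i = Suc n then 1 else 0)" for i
    by (auto simp: p_def coeff_Poly_eq nth_default_def nth_append less_Suc_eq_le simp del: upt_Suc)
  have deg: "Polynomial.degree p = Suc n"
    by (intro antisym degree_le le_degree) (auto simp: cp)
  have lc: "Polynomial.lead_coeff p = 1" by (simp add: deg cp)
  have "to_fract a * poly (map_poly to_fract p) x = (\<Sum>i\<le>Suc n. to_fract (poly.coeff p i * c i))"
    by (simp add: poly_altdef deg degree_map_poly coeff_map_poly sum_distrib_left cx algebra_simps
        del: sum.atMost_Suc)
  also have "\<dots> = to_fract (c (Suc n)) - (\<Sum>i\<le>n. to_fract (d i * c i))"
    by (simp add: cp sum_negf)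
  also have "\<dots> = 0"
    by (subst rel) (simp add: to_fract_sum)
  finally have "poly (map_poly to_fract p) x = 0" using a' by simp
  then obtain y where "x = to_fract y"
    using dedekind lc by (auto simp: dedekind_domain_def integrally_closed_def)
  then have "to_fract b = to_fract (a * y)"
    using a' by (simp add: x_def field_simps)
  then show ?thesis by (simp del: to_fract_mult)
qed

text \<open>The last property says that \<open>p\<close> generates the maximal ideal of the localization at \<open>M\<close>.\<close>

lemma uniformizer:
  fixes M :: "'a set"
  assumes M: "maximal_ideal_of M" "M \<noteq> {0}"
  obtains p c where "p \<in> M" "c \<notin> M" "\<And>m. m \<in> M \<Longrightarrow> p dvd c * m"
proof -
  have I: "ideal_of M" using M by (simp add: maximal_ideal_iff)
  obtain a where a: "a \<in> M" "a \<noteq> 0" using M ideal_zero[OF I] by auto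
  obtain b where b: "\<And>d. a dvd d * b \<longleftrightarrow> d \<in> M" using prime_annihilator[OF M(1) a] by blast
  \<comment> \<open>For \<open>x = b / a\<close>, the choice of \<open>b\<close> gives
    \<open>x M \<subseteq> D\<close>. An element \<open>p\<close> of \<open>M\<close> with
    \<open>x p\<close> outside \<open>M\<close> is a uniformizer. If there is none, then
    \<open>x M \<subseteq> M\<close>, and the ascending chain condition makes \<open>x\<close>
    integral over \<open>D\<close>.\<close>
  have "\<exists>p\<in>M. \<exists>c. b * p = a * c \<and> c \<notin> M"
  proof (rule ccontr)
    assume "\<not> ?thesis"
    then have step: "\<exists>c'. c' \<in> M \<and> b * c = a * c'" if "c \<in> M" for c
      using that b[of c] unfolding dvd_def by (metis mult.commute)
    obtain c where c: "c 0 = a" "\<And>n. c n \<in> M" "\<And>n. b * c n = a * c (Suc n)"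
      using dependent_nat_choice[of "\<lambda>n c. c \<in> M \<and> (n = 0 \<longrightarrow> c = a)" "\<lambda>n c c'. b * c = a * c'"] a step
      by auto
    define f where "f d n = (\<Sum>i\<le>n. d i * c i)" for d n
    \<comment> \<open>\<open>J n\<close> is the ideal generated by \<open>c 0, ..., c n\<close>.
      Once the chain stabilizes, the next \<open>c\<close> is a combination of the earlier ones,
      which is the integral equation.\<close>
    define J where "J n = {f d n | d. True}" for n
    have J: "ideal_of (J n)" for n
      unfolding ideal_iff
    proof (intro conjI ballI allI)
      have "f (\<lambda>_. 0) n = 0" by (simp add: f_def)
      then show "0 \<in> J n" unfolding J_def by force
      show "x + y \<in> J n" if xy: "x \<in> J n" "y \<in> J n" for x y
      proof -
        obtain d d' where "x = f d n" "y = f d' n" using xy unfolding J_def by blast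
        then have "x + y = f (\<lambda>i. d i + d' i) n" by (simp add: f_def distrib_right sum.distrib)
        then show ?thesis unfolding J_def by blast
      qed
      show "r * x \<in> J n" if x: "x \<in> J n" for x r
      proof -
        obtain d where "x = f d n" using x unfolding J_def by blast
        then have "r * x = f (\<lambda>i. r * d i) n" by (simp add: f_def sum_distrib_left mult.assoc)
        then show ?thesis unfolding J_def by blast
      qed
    qed
    have "J n \<subseteq> J (Suc n)" for n
    proof
      fix x assume "x \<in> J n"
      then obtain d where "x = f d n" unfolding J_def by blast
      then have "x = f (\<lambda>i. if i \<le> n then d i else 0) (Suc n)" by (simp add: f_def)
      then show "x \<in> J (Suc n)" unfolding J_def by blast
    qed
    then obtain n where n: "J (Suc n) = J n" using ascending_chain_stabilizes J by blast
    have "(if i = Suc n then 1 else 0) * c i = (if i = Suc n then c i else 0)" for i by simp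
    then have "c (Suc n) = f (\<lambda>i. if i = Suc n then 1 else 0) (Suc n)" by (simp add: f_def)
    then have "c (Suc n) \<in> J (Suc n)" unfolding J_def by blast
    then obtain d where "c (Suc n) = (\<Sum>i\<le>n. d i * c i)"
      unfolding n f_def[symmetric] unfolding J_def by blast
    then have "a dvd b" by (rule integral_imp_dvd[OF a(2) c(1,3)])
    then show False using b[of 1] M by (simp add: maximal_ideal_iff)
  qed
  then obtain p c where pc: "p \<in> M" "b * p = a * c" "c \<notin> M" by blast
  \<comment> \<open>Write \<open>m b = a d\<close>. Multiplying \<open>b p = a c\<close> by
    \<open>m\<close> gives \<open>a c m = p m b = a p d\<close>, and \<open>a\<close>
    cancels.\<close>
  have "p dvd c * m" if m: "m \<in> M" for m
  proof -
    obtain d where d: "m * b = a * d" using b[of m] m by (auto simp: dvd_def)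
    have "a * (c * m) = p * (m * b)" using pc by (simp add: mult_ac)
    also have "\<dots> = a * (p * d)" unfolding d by (simp add: mult_ac)
    finally have "c * m = p * d" using a by simp
    then show ?thesis by simp
  qed
  then show thesis using that pc by blast
qed

end

section \<open>Local parts of ideals\<close>

text \<open>The contraction to \<open>D\<close> of the extension of \<open>I\<close> to the localization at \<open>M\<close>.\<close>

definition local_part :: "'a::idom set \<Rightarrow> 'a set \<Rightarrow> 'a set" where
  "local_part M I = {z. \<exists>s. s \<notin> M \<and> s * z \<in> I}"

lemma ideal_local_part:
  assumes M: "prime_ideal_of M" and I: "ideal_of I"
  shows "ideal_of (local_part M I)"
  unfolding ideal_iff
proof (intro conjI ballI allI)
  have "1 \<notin> M" using M by (simp add: prime_ideal_iff)
  then show "0 \<in> local_part M I"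
    unfolding local_part_def using ideal_zero[OF I] by (intro CollectI exI[of _ 1]) simp
next
  fix x y assume "x \<in> local_part M I" "y \<in> local_part M I"
  then obtain s t where st: "s \<notin> M" "s * x \<in> I" "t \<notin> M" "t * y \<in> I" by (auto simp: local_part_def)
  have "t * (s * x) + s * (t * y) \<in> I" 
    by (rule ideal_add[OF I ideal_mult_left[OF I st(2)] ideal_mult_left[OF I st(4)]])
  then have "(s * t) * (x + y) \<in> I" by (simp add: algebra_simps)
  moreover have "s * t \<notin> M" using st M by (auto simp: prime_ideal_iff)
  ultimately show "x + y \<in> local_part M I" unfolding local_part_def by blast
next
  fix x r assume "x \<in> local_part M I"
  then obtain s where "s \<notin> M" "s * x \<in> I" by (auto simp: local_part_def)
  then show "r * x \<in> local_part M I"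
    unfolding local_part_def using ideal_mult_left[OF I, of "s * x" r]
    by (intro CollectI exI[of _ s]) (simp add: mult.left_commute)
qed

text \<open>Elements outside \<open>M\<close> become units in the localization.\<close>

lemma local_part_cancel:
  assumes "prime_ideal_of M" "s \<notin> M" "s * z \<in> local_part M I"
  shows "z \<in> local_part M I"
proof -
  obtain t where "t \<notin> M" "t * (s * z) \<in> I" using assms(3) by (auto simp: local_part_def)
  moreover have "t * s \<notin> M" using assms(1,2) \<open>t \<notin> M\<close> by (auto simp: prime_ideal_iff)
  ultimately show ?thesis unfolding local_part_def by (auto simp: mult.assoc[symmetric])
qed

lemma subset_local_part: "1 \<notin> M \<Longrightarrow> I \<subseteq> local_part M I"
  unfolding local_part_def by (auto intro!: exI[of _ 1])

lemma local_part_mono: "I \<subseteq> J \<Longrightarrow> local_part M I \<subseteq> local_part M J"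
  unfolding local_part_def by blast

lemma local_part_subset: "prime_ideal_of M \<Longrightarrow> I \<subseteq> M \<Longrightarrow> local_part M I \<subseteq> M"
  unfolding local_part_def prime_ideal_iff by blast

text \<open>For a nonzero ideal \<open>I\<close> and a uniformizer \<open>p\<close> at
  \<open>M\<close>, this is the exponent of \<open>M\<close> in the factorization of
  \<open>I\<close>.\<close>

definition local_order :: "'a::idom set \<Rightarrow> 'a \<Rightarrow> 'a set \<Rightarrow> nat" where
  "local_order M p I = (LEAST k. p ^ k \<in> local_part M I)"

context dedekind
begin

text \<open>If \<open>z\<close> is not in \<open>I\<close>, the colon ideal \<open>(I : z)\<close>
  lies in some maximal \<open>M\<close>, which is then above \<open>I\<close>; a witness for
  \<open>z\<close> in the local part at \<open>M\<close> would be an element of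
  \<open>(I : z)\<close> outside \<open>M\<close>.\<close>

lemma in_all_local_parts:
  fixes I :: "'a set"
  assumes I: "ideal_of I"
    and z: "\<And>M. maximal_ideal_of M \<Longrightarrow> I \<subseteq> M \<Longrightarrow> z \<in> local_part M I"
  shows "z \<in> I"
proof (rule ccontr)
  assume "z \<notin> I"
  then have "1 \<notin> {d. d * z \<in> I}" by simp
  then obtain M where M: "maximal_ideal_of M" "{d. d * z \<in> I} \<subseteq> M"
    using maximal_ideal_above[OF ideal_colon[OF I]] by blast
  have "I \<subseteq> M" using M(2) ideal_mult_right[OF I] by blast
  then show False using z[OF M(1)] M(2) unfolding local_part_def by blast
qed

section \<open>Powers of a uniformizer and the order at a maximal ideal\<close>

context
  fixes M :: "'a set" and p c :: 'a
  assumes M: "maximal_ideal_of M" and p: "p \<in> M" and c: "c \<notin> M"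
    and uniformizing: "\<And>m. m \<in> M \<Longrightarrow> p dvd c * m"
begin

lemma power_local_unit: "c ^ k \<notin> M"
  using maximal_ideal_prime[OF M] c prime_ideal_power by blast

text \<open>In the localization, \<open>a\<close> is a unit times \<open>p ^ k\<close>. As long as
  \<open>a\<close> lies in \<open>M\<close>, it can be divided by \<open>p\<close> there; this
  terminates because the local part of the principal ideal grows strictly with each
  division.\<close>

lemma local_factorization:
  assumes "a \<noteq> 0"
  obtains k y where "y \<notin> M" "c ^ k * a = p ^ k * y"
proof -
  have prime: "prime_ideal_of M" by (rule maximal_ideal_prime[OF M])
  define D where "D a = {d. a dvd d}" for a :: 'a
  have D: "ideal_of (D a)" for a by (auto simp: D_def ideal_iff)
  have "a \<noteq> 0 \<Longrightarrow> I = local_part M (D a) \<Longrightarrow> \<exists>k y. y \<notin> M \<and> c ^ k * a = p ^ k * y"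
    if "ideal_of I" for I
    using that
  proof (induction arbitrary: a rule: noetherian_induct)
    case (less I a)
    show ?case
    proof (cases "a \<in> M")
      case False
      then show ?thesis by (intro exI[of _ 0] exI[of _ a]) simp
    next
      case True
      then obtain a' where a': "c * a = p * a'" using uniformizing by (auto simp: dvd_def)
      have "a' \<noteq> 0"
        using a' less.prems c ideal_zero[of M] prime by (auto simp: prime_ideal_iff)
      have "a \<in> local_part M (D a')" using c a' by (auto simp: local_part_def D_def)
      then have "D a \<subseteq> local_part M (D a')"
        using ideal_mult_right[OF ideal_local_part[OF prime D]] by (auto simp: D_def elim!: dvdE)
      then have sub: "local_part M (D a) \<subseteq> local_part M (D a')"
        using local_part_cancel[OF prime] by (auto simp: local_part_def[of M "D a"])
      have "a' \<notin> local_part M (D a)"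
      proof
        assume "a' \<in> local_part M (D a)"
        then obtain s t where st: "s \<notin> M" "s * a' = a * t" by (auto simp: local_part_def D_def dvd_def)
        have "a' * (c * s) = c * (a * t)" using st by (simp add: mult_ac)
        also have "\<dots> = a' * (p * t)" 
          by (simp only: a' mult.assoc[symmetric]) (simp only: mult_ac)
        finally have "c * s = p * t" using \<open>a' \<noteq> 0\<close> by simp
        then have "c * s \<in> M" using p prime ideal_mult_right[of M p t] by (simp add: prime_ideal_iff)
        then show False using prime c st by (auto simp: prime_ideal_iff)
      qed
      moreover have "a' \<in> local_part M (D a')"
        using subset_local_part[of M "D a'"] prime by (auto simp: D_def prime_ideal_iff)
      ultimately have "I \<subset> local_part M (D a')" using sub less.prems by blast
      then obtain k y where "y \<notin> M" "c ^ k * a' = p ^ k * y"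
        using less.IH[OF ideal_local_part[OF prime D]] \<open>a' \<noteq> 0\<close> by blast
      moreover have "c ^ Suc k * a = p * (c ^ k * a')"
        by (simp only: power_Suc2 mult.assoc a') (simp only: mult.left_commute)
      ultimately show ?thesis by (intro exI[of _ "Suc k"] exI[of _ y]) (simp add: mult.assoc)
    qed
  qed
  then show thesis using that assms ideal_local_part[OF prime D] by blast
qed

text \<open>In the localization \<open>y\<close> and \<open>p ^ k\<close> are associates, so one
  \<open>k\<close> serves all ideals \<open>I\<close> at once.\<close>

lemma mem_local_part_iff_power:
  assumes "y \<noteq> 0"
  obtains k where "\<And>I. ideal_of I \<Longrightarrow> y \<in> local_part M I \<longleftrightarrow> p ^ k \<in> local_part M I"
proof -
  have prime: "prime_ideal_of M" by (rule maximal_ideal_prime[OF M])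
  obtain k u where u: "u \<notin> M" "c ^ k * y = p ^ k * u" using local_factorization[OF assms] .
  show thesis
  proof (rule that[of k])
    fix I :: "'a set" assume I: "ideal_of I"
    note L = ideal_local_part[OF prime I]
    show "y \<in> local_part M I \<longleftrightarrow> p ^ k \<in> local_part M I"
    proof
      assume "y \<in> local_part M I"
      then have "u * p ^ k \<in> local_part M I"
        using ideal_mult_left[OF L, of y "c ^ k"] u by (simp add: mult.commute)
      then show "p ^ k \<in> local_part M I" using local_part_cancel[OF prime u(1)] by blast
    next
      assume "p ^ k \<in> local_part M I"
      then have "c ^ k * y \<in> local_part M I" using ideal_mult_right[OF L] u by simp
      then show "y \<in> local_part M I" using local_part_cancel[OF prime power_local_unit] by blast
    qed
  qed
qed

lemma power_mem_local_part:
  assumes q: "ideal_of q" "q \<noteq> {0}"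
  obtains k where "p ^ k \<in> local_part M q"
proof -
  obtain a where a: "a \<in> q" "a \<noteq> 0" using q ideal_zero[OF q(1)] by auto
  have "a \<in> local_part M q"
    using subset_local_part[of M q] a M by (auto simp: maximal_ideal_iff)
  then show thesis using mem_local_part_iff_power[OF a(2)] q that by blast
qed

text \<open>A nonzero \<open>y\<close> in the local part of \<open>I\<close> behaves like a power
  \<open>p ^ k\<close> whose exponent is at least the order of \<open>I\<close>, hence at least that
  of \<open>J\<close>. So local parts at \<open>M\<close> are linearly ordered, reversely to their
  orders.\<close>

lemma local_part_antimono_order:
  assumes I: "ideal_of I" and J: "ideal_of J" "J \<noteq> {0}"
    and le: "local_order M p J \<le> local_order M p I"
  shows "local_part M I \<subseteq> local_part M J"
proof
  have prime: "prime_ideal_of M" by (rule maximal_ideal_prime[OF M])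
  note L = ideal_local_part[OF prime J(1)]
  fix y assume y: "y \<in> local_part M I"
  show "y \<in> local_part M J"
  proof (cases "y = 0")
    case True
    then show ?thesis using ideal_zero[OF L] by simp
  next
    case False
    obtain k where k: "\<And>I. ideal_of I \<Longrightarrow> y \<in> local_part M I \<longleftrightarrow> p ^ k \<in> local_part M I"
      using mem_local_part_iff_power[OF False] by blast
    have "local_order M p I \<le> k" unfolding local_order_def using y k[OF I] by (intro Least_le) simp
    moreover obtain j where "p ^ j \<in> local_part M J" using power_mem_local_part[OF J] .
    then have "p ^ local_order M p J \<in> local_part M J" unfolding local_order_def by (rule LeastI)
    ultimately have "p ^ (k - local_order M p J) * p ^ local_order M p J \<in> local_part M J"
      by (intro ideal_mult_left[OF L])
    then show ?thesis using k[OF J(1)] le \<open>local_order M p I \<le> k\<close> by (simp flip: power_add)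
  qed
qed

end

text \<open>A power \<open>p ^ k\<close> in the local part of \<open>q\<close> bounds the orders of
  all members by \<open>k\<close>, so a largest and a smallest order occur. They give the least and
  the greatest local part respectively.\<close>

lemma extremal_local_parts:
  fixes q M :: "'a set"
  assumes q: "ideal_of q" "q \<noteq> {0}" and M: "maximal_ideal_of M" "q \<subseteq> M"
    and F: "\<F> \<noteq> {}" "\<And>I. I \<in> \<F> \<Longrightarrow> ideal_of I \<and> q \<subseteq> I"
  shows "\<exists>I\<in>\<F>. \<forall>J\<in>\<F>. local_part M I \<subseteq> local_part M J"
    and "\<exists>I\<in>\<F>. \<forall>J\<in>\<F>. local_part M J \<subseteq> local_part M I"
proof -
  have nz: "J \<noteq> {0}" if "q \<subseteq> J" for J using that q ideal_zero[OF q(1)] by auto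
  obtain p c where pc: "p \<in> M" "c \<notin> M" "\<And>m. m \<in> M \<Longrightarrow> p dvd c * m"
    using uniformizer[OF M(1) nz[OF M(2)]] by blast
  note antimono = local_part_antimono_order[OF M(1) pc]
  let ?ord = "local_order M p"
  obtain k where k: "p ^ k \<in> local_part M q" using power_mem_local_part[OF M(1) pc q] .
  have bound: "?ord I < Suc k" if "I \<in> \<F>" for I
  proof -
    have "p ^ k \<in> local_part M I" using k local_part_mono F(2)[OF that] by blast
    then show ?thesis unfolding local_order_def by (simp add: less_Suc_eq_le Least_le)
  qed
  obtain I0 where "I0 \<in> \<F>" using F by blast
  then obtain I where "I \<in> \<F>" "\<And>J. J \<in> \<F> \<Longrightarrow> ?ord J \<le> ?ord I"
    using ex_has_greatest_nat[of "\<lambda>I. I \<in> \<F>" I0 ?ord "Suc k"] bound by (meson less_imp_le)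
  then show "\<exists>I\<in>\<F>. \<forall>J\<in>\<F>. local_part M I \<subseteq> local_part M J"
    using antimono F(2) nz by meson
  obtain I where "I \<in> \<F>" "\<And>J. J \<in> \<F> \<Longrightarrow> ?ord I \<le> ?ord J"
    using ex_has_least_nat[of "\<lambda>I. I \<in> \<F>" I0 ?ord] \<open>I0 \<in> \<F>\<close> by blast
  then show "\<exists>I\<in>\<F>. \<forall>J\<in>\<F>. local_part M J \<subseteq> local_part M I"
    using antimono F(2) nz by meson
qed

text \<open>From \<open>c m = p t\<close> follows \<open>c ^ k m ^ k = p ^ k t ^ k\<close>, and
  \<open>c ^ k\<close> cancels. Thus \<open>M\<close> is the radical of the local part.\<close>

lemma power_mem_local_part_of_maximal:
  assumes q: "ideal_of q" "q \<noteq> {0}" and M: "maximal_ideal_of M" "q \<subseteq> M" and m: "(m :: 'a) \<in> M"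
  obtains k where "m ^ k \<in> local_part M q"
proof -
  have prime: "prime_ideal_of M" by (rule maximal_ideal_prime[OF M(1)])
  note L = ideal_local_part[OF prime q(1)]
  have "M \<noteq> {0}" using q M(2) ideal_zero[OF q(1)] by auto
  then obtain p c where pc: "p \<in> M" "c \<notin> M" "\<And>m. m \<in> M \<Longrightarrow> p dvd c * m"
    using uniformizer[OF M(1)] by blast
  obtain k where k: "p ^ k \<in> local_part M q" using power_mem_local_part[OF M(1) pc q] .
  obtain t where "c * m = p * t" using pc(3)[OF m] by (auto simp: dvd_def)
  then have "c ^ k * m ^ k = p ^ k * t ^ k" by (metis power_mult_distrib)
  then have "c ^ k * m ^ k \<in> local_part M q" using ideal_mult_right[OF L k] by simp
  then show thesis
    using local_part_cancel[OF prime power_local_unit[OF M(1) pc]] that by blast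
qed

text \<open>\<open>N\<close> contains a power of each element of \<open>M\<close>, hence
  \<open>M\<close> itself. So \<open>D\<close> modulo the local part is a local ring.\<close>

lemma unique_maximal_above_local_part:
  fixes q :: "'a set"
  assumes q: "ideal_of q" "q \<noteq> {0}" and M: "maximal_ideal_of M" "q \<subseteq> M"
    and N: "maximal_ideal_of N" "local_part M q \<subseteq> N"
  shows "N = M"
proof -
  have "m \<in> N" if m: "m \<in> M" for m
  proof -
    obtain k where "m ^ k \<in> local_part M q" using power_mem_local_part_of_maximal[OF q M m] .
    then show ?thesis using N prime_ideal_power[OF maximal_ideal_prime[OF N(1)]] by blast
  qed
  then have "M \<subseteq> N" by blast
  moreover have "ideal_of N" "1 \<notin> N" using N(1) by (simp_all add: maximal_ideal_iff)
  ultimately show ?thesis using M(1) by (simp add: maximal_ideal_iff)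
qed

text \<open>A maximal ideal above the local part and \<open>s\<close> would have to be
  \<open>M\<close>, which does not contain \<open>s\<close>.\<close>

lemma inverse_mod_local_part:
  fixes q :: "'a set"
  assumes q: "ideal_of q" "q \<noteq> {0}" and M: "maximal_ideal_of M" "q \<subseteq> M" and s: "s \<notin> M"
  obtains t where "t * s - 1 \<in> local_part M q"
proof -
  note L = ideal_local_part[OF maximal_ideal_prime[OF M(1)] q(1)]
  define J where "J = {d * s + z | d z. z \<in> local_part M q}"
  have J: "ideal_of J" unfolding J_def by (rule ideal_principal_plus[OF L])
  have "s \<in> J" unfolding J_def using ideal_zero[OF L] by (force intro: exI[of _ 1])
  have sub: "local_part M q \<subseteq> J" unfolding J_def by (force intro: exI[of _ 0])
  have "1 \<in> J"
  proof (rule ccontr)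
    assume "1 \<notin> J"
    then obtain N where N: "maximal_ideal_of N" "J \<subseteq> N" using maximal_ideal_above[OF J] by blast
    then have "N = M" using unique_maximal_above_local_part[OF q M N(1)] sub by simp
    then show False using N(2) s \<open>s \<in> J\<close> by auto
  qed
  then obtain t z where tz: "1 = t * s + z" "z \<in> local_part M q" unfolding J_def by blast
  have "t * s - 1 = - z" by (subst tz(1)) simp
  then have "t * s - 1 \<in> local_part M q" using ideal_uminus[OF L tz(2)] by simp
  then show thesis by (rule that)
qed

text \<open>A Chinese remainder element: a product of elements of the other local parts chosen
  outside \<open>M\<close>, made congruent to \<open>1\<close> at \<open>M\<close> by an inverse
  modulo the local part there.\<close>

lemma local_idempotent:
  fixes q :: "'a set"
  assumes q: "ideal_of q" "q \<noteq> {0}" and M: "maximal_ideal_of M" "q \<subseteq> M"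
    and S: "finite S" "\<And>N. N \<in> S \<Longrightarrow> maximal_ideal_of N \<and> q \<subseteq> N \<and> N \<noteq> M"
  obtains e where "1 - e \<in> local_part M q" "\<And>N. N \<in> S \<Longrightarrow> e \<in> local_part N q"
proof -
  have prime: "prime_ideal_of M" by (rule maximal_ideal_prime[OF M(1)])
  have L: "ideal_of (local_part N q)" if "maximal_ideal_of N" for N
    by (rule ideal_local_part[OF maximal_ideal_prime[OF that] q(1)])
  have "\<exists>e. e \<notin> M \<and> (\<forall>N\<in>S. e \<in> local_part N q)"
    using S
  proof (induction S rule: finite_induct)
    case empty
    show ?case using prime by (auto simp: prime_ideal_iff)
  next
    case (insert N S)
    then obtain e where e: "e \<notin> M" "\<forall>N\<in>S. e \<in> local_part N q" by blast
    have N: "maximal_ideal_of N" "q \<subseteq> N" "N \<noteq> M" using insert.prems by auto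
    then obtain r where r: "r \<in> local_part N q" "r \<notin> M"
      using unique_maximal_above_local_part[OF q N(1,2) M(1)] by blast
    have "e * r \<notin> M" using e r prime by (auto simp: prime_ideal_iff)
    moreover have "e * r \<in> local_part K q" if "K \<in> insert N S" for K
      using that e(2) r(1) insert.prems[of K] L[of K] ideal_mult_left ideal_mult_right by blast
    ultimately show ?case by blast
  qed
  then obtain s where s: "s \<notin> M" "\<And>N. N \<in> S \<Longrightarrow> s \<in> local_part N q" by blast
  obtain t where t: "t * s - 1 \<in> local_part M q" using inverse_mod_local_part[OF q M s(1)] .
  show thesis
  proof (rule that)
    show "1 - t * s \<in> local_part M q" using ideal_uminus[OF L[OF M(1)] t] by simp
    show "t * s \<in> local_part N q" if "N \<in> S" for N
      using s(2)[OF that] L S(2)[OF that] ideal_mult_left by blast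
  qed
qed

end

section \<open>Gluing matrices in \<open>SL\<^sub>2\<close>\<close>

definition mat_cong :: "'a::comm_ring_1 set \<Rightarrow> 'a^2^2 \<Rightarrow> 'a^2^2 \<Rightarrow> bool" where
  "mat_cong I A B \<longleftrightarrow> (\<forall>i j. A $ i $ j - B $ i $ j \<in> I)"

lemma mat_cong_refl: "ideal_of I \<Longrightarrow> mat_cong I A A"
  by (simp add: mat_cong_def ideal_zero)

lemma mat_cong_sym: "ideal_of I \<Longrightarrow> mat_cong I A B \<Longrightarrow> mat_cong I B A"
  unfolding mat_cong_def using ideal_uminus by (metis minus_diff_eq)

lemma mat_cong_trans:
  assumes I: "ideal_of I" and "mat_cong I A B" "mat_cong I B C"
  shows "mat_cong I A C"
  unfolding mat_cong_def
proof (intro allI)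
  fix i j
  have "(A $ i $ j - B $ i $ j) + (B $ i $ j - C $ i $ j) \<in> I"
    using assms(2,3) by (intro ideal_add[OF I]) (simp_all add: mat_cong_def)
  then show "A $ i $ j - C $ i $ j \<in> I" by simp
qed

lemma mat_cong_mult:
  assumes I: "ideal_of I" and "mat_cong I A A'" "mat_cong I B B'"
  shows "mat_cong I (A ** B) (A' ** B')"
  unfolding mat_cong_def
proof (intro allI)
  fix i j
  have "(A ** B) $ i $ j - (A' ** B') $ i $ j =
      (\<Sum>k\<in>UNIV. (A $ i $ k - A' $ i $ k) * B $ k $ j + A' $ i $ k * (B $ k $ j - B' $ k $ j))"
    by (simp add: matrix_matrix_mult_def sum_subtractf sum.distrib algebra_simps)
  also have "\<dots> \<in> I"
    using assms(2,3)
    by (intro ideal_sum_closed[OF I] ideal_add[OF I] ideal_mult_right[OF I] ideal_mult_left[OF I])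
      (simp_all add: mat_cong_def)
  finally show "(A ** B) $ i $ j - (A' ** B') $ i $ j \<in> I" .
qed

lemma mat_cong_inv:
  assumes I: "ideal_of I" and AB: "mat_cong I A B" and "A \<in> carrier SL2" "B \<in> carrier SL2"
  shows "mat_cong I (inv\<^bsub>SL2\<^esub> A) (inv\<^bsub>SL2\<^esub> B)"
proof -
  have neg: "- x - - y \<in> I" if "x - y \<in> I" for x y
    using ideal_uminus[OF I that] by simp
  show ?thesis
    using AB neg by (simp add: inv_SL2 assms mat_cong_def forall_2 del: minus_diff_minus)
qed

lemma mat_cong_SL2_principal:
  "A \<in> carrier SL2 \<Longrightarrow> mat_cong I A (mat 1) \<Longrightarrow> A \<in> SL2_principal I"
  by (simp add: mat_cong_def SL2_principal_def)

lemma one_SL2: "\<one>\<^bsub>SL2\<^esub> = mat 1" by (simp add: SL2_def)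

lemma mult_closed_SL2: "A \<in> carrier SL2 \<Longrightarrow> B \<in> carrier SL2 \<Longrightarrow> A ** B \<in> carrier SL2"
  by (simp add: SL2_def det_mul)

lemma inv_closed_SL2: "A \<in> carrier SL2 \<Longrightarrow> inv\<^bsub>SL2\<^esub> A \<in> carrier SL2"
  by (rule group.inv_closed[OF SL2_group])

lemma inv_mult_SL2:
  assumes "A \<in> carrier SL2"
  shows "inv\<^bsub>SL2\<^esub> A ** A = mat 1" "A ** inv\<^bsub>SL2\<^esub> A = mat 1"
  using group.l_inv[OF SL2_group assms] group.r_inv[OF SL2_group assms]
  by (simp_all add: mult_SL2 one_SL2)

lemma T_entries: "T x $ 1 $ 1 = 1" "T x $ 1 $ 2 = x" "T x $ 2 $ 1 = 0" "T x $ 2 $ 2 = 1"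
  by (simp_all add: T_def)

lemma transpose_T_car: "transpose (T x) \<in> carrier SL2"
  using T_car[of x] by (simp add: SL2_def det_transpose)

lemma mat_cong_T: "ideal_of I \<Longrightarrow> x - y \<in> I \<Longrightarrow> mat_cong I (T x) (T y)"
  by (simp add: mat_cong_def forall_2 T_entries ideal_zero)

lemma mat_cong_transpose: "mat_cong I A B \<Longrightarrow> mat_cong I (transpose A) (transpose B)"
  by (simp add: mat_cong_def transpose_def)

lemma T_zero: "T 0 = mat 1"
  using T_0 by (simp add: one_SL2)

context dedekind
begin

text \<open>Modulo the local part, \<open>g\<close> is a product of matrices \<open>T x\<close> and
  their transposes. Replacing each \<open>x\<close> by \<open>e * x\<close> changes nothing modulo
  the local part and makes every factor trivial modulo \<open>R\<close>.\<close>

lemma SL2_lift_local: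
  fixes q R :: "'a set" and g :: "'a^2^2"
  assumes q: "ideal_of q" "q \<noteq> {0}" and M: "maximal_ideal_of M" "q \<subseteq> M"
    and R: "ideal_of R" and e: "1 - e \<in> local_part M q" "e \<in> R"
    and g: "g \<in> carrier SL2"
  obtains h where "h \<in> carrier SL2" "mat_cong (local_part M q) h g" "mat_cong R h (mat 1)"
proof -
  let ?Q = "local_part M q"
  have prime: "prime_ideal_of M" by (rule maximal_ideal_prime[OF M(1)])
  note Q = ideal_local_part[OF prime q(1)]
  define liftable where
    "liftable g \<longleftrightarrow> (\<exists>h\<in>carrier SL2. mat_cong ?Q h g \<and> mat_cong R h (mat 1))" for g
  have mult: "liftable (A ** B)" if AB: "liftable A" "liftable B" for A B
  proof -
    obtain A' B' where A': "A' \<in> carrier SL2" "mat_cong ?Q A' A" "mat_cong R A' (mat 1)"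
      and B': "B' \<in> carrier SL2" "mat_cong ?Q B' B" "mat_cong R B' (mat 1)"
      using AB by (auto simp: liftable_def)
    have "mat_cong R (A' ** B') (mat 1)"
      using mat_cong_mult[OF R A'(3) B'(3)] by simp
    then show ?thesis
      unfolding liftable_def
      using mult_closed_SL2[OF A'(1) B'(1)] mat_cong_mult[OF Q A'(2) B'(2)] by blast
  qed
  have elem: "mat_cong ?Q (T (e * x)) (T x)" "mat_cong R (T (e * x)) (mat 1)" for x
  proof -
    have "- ((1 - e) * x) \<in> ?Q" using e by (intro ideal_uminus[OF Q] ideal_mult_right[OF Q])
    then show "mat_cong ?Q (T (e * x)) (T x)" by (intro mat_cong_T[OF Q]) (simp add: algebra_simps)
    show "mat_cong R (T (e * x)) (mat 1)"
      unfolding T_zero[symmetric] using e R ideal_mult_right by (intro mat_cong_T) auto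
  qed
  have T: "liftable (T x)" for x
    unfolding liftable_def using elem T_car by blast
  have T': "liftable (transpose (T x))" for x
    unfolding liftable_def
    using mat_cong_transpose[OF elem(1)[of x]] mat_cong_transpose[OF elem(2)[of x]] transpose_T_car
    by (metis transpose_mat)
  have cong: "liftable A" if "liftable B" "mat_cong ?Q B A" for A B
    using that mat_cong_trans[OF Q] by (auto simp: liftable_def)
  txt \<open>
    If \<open>c\<close> is a unit modulo \<open>Q\<close> with inverse \<open>t\<close>, the matrix with rows \<open>(a, b)\<close>, \<open>(c, d)\<close> and
    determinant \<open>1\<close> is \<open>T(t(a - 1)) L(c) T(t(d - 1))\<close> modulo \<open>Q\<close>, where \<open>L(c)\<close> is the transpose of
    \<open>T(c)\<close>.
  \<close>
  have lower_unit: "liftable A" if A: "A \<in> carrier SL2" "A $ 2 $ 1 \<notin> M" for A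
  proof -
    let ?a = "A $ 1 $ 1" and ?b = "A $ 1 $ 2" and ?c = "A $ 2 $ 1" and ?d = "A $ 2 $ 2"
    obtain t where t: "t * ?c - 1 \<in> ?Q" using inverse_mod_local_part[OF q M A(2)] .
    have det: "?a * ?d - ?b * ?c = 1" using A by (simp add: SL2_def det_2)
    define x y where "x = t * (?a - 1)" and "y = t * (?d - 1)"
    define B where "B = T x ** transpose (T ?c) ** T y"
    have B: "B $ 1 $ 1 = 1 + x * ?c" "B $ 1 $ 2 = (1 + x * ?c) * y + x" "B $ 2 $ 1 = ?c"
      "B $ 2 $ 2 = ?c * y + 1"
      by (simp_all add: B_def matrix_matrix_mult_def sum_2 transpose_def T_entries)
    have 11: "1 + x * ?c - ?a \<in> ?Q"
      using ideal_mult_left[OF Q t, of "?a - 1"] by (simp add: x_def algebra_simps)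
    have 22: "?c * y + 1 - ?d \<in> ?Q"
      using ideal_mult_left[OF Q t, of "?d - 1"] by (simp add: y_def algebra_simps)
    \<comment> \<open>\<open>B\<close> and \<open>A\<close> both have determinant \<open>1\<close>
      and agree modulo \<open>?Q\<close> in the other three entries. Hence \<open>?c\<close> times
      the difference of their upper right entries lies in \<open>?Q\<close>, and \<open>?c\<close>
      cancels.\<close>
    have "(1 + x * ?c - ?a) * (?c * y + 1) + ?a * (?c * y + 1 - ?d) \<in> ?Q"
      using 11 22 by (intro ideal_add[OF Q] ideal_mult_left[OF Q] ideal_mult_right[OF Q])
    also have "(1 + x * ?c - ?a) * (?c * y + 1) + ?a * (?c * y + 1 - ?d) =
        (1 + x * ?c) * (?c * y + 1) - ?a * ?d"
      by (simp add: algebra_simps)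
    also have "\<dots> = (1 + x * ?c) * (?c * y + 1) - (1 + ?b * ?c)"
      using det by (simp add: algebra_simps)
    also have "\<dots> = ?c * ((1 + x * ?c) * y + x - ?b)" by (simp add: algebra_simps)
    finally have 12: "(1 + x * ?c) * y + x - ?b \<in> ?Q"
      using local_part_cancel[OF prime A(2)] by blast
    have "mat_cong ?Q B A"
      unfolding mat_cong_def forall_2 B using 11 12 22 ideal_zero[OF Q] by simp
    then show ?thesis using cong mult T T' unfolding B_def by blast
  qed
  have "liftable g"
  proof (cases "g $ 2 $ 1 \<in> M")
    case False
    then show ?thesis using lower_unit g by blast
  next
    case True
    have I: "ideal_of M" "1 \<notin> M" using prime by (simp_all add: prime_ideal_iff)
    have det: "g $ 1 $ 1 * g $ 2 $ 2 - g $ 1 $ 2 * g $ 2 $ 1 = 1" using g by (simp add: SL2_def det_2)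
    have "g $ 1 $ 1 \<notin> M"
    proof
      assume "g $ 1 $ 1 \<in> M"
      then have "g $ 1 $ 1 * g $ 2 $ 2 - g $ 1 $ 2 * g $ 2 $ 1 \<in> M"
        using True ideal_mult_right[OF I(1)] ideal_mult_left[OF I(1)] by (intro ideal_diff[OF I(1)])
      then show False using I(2) by (simp only: det)
    qed
    \<comment> \<open>Adding the first row to the second moves the lower left entry out of
      \<open>M\<close>.\<close>
    define A where "A = transpose (T 1) ** g"
    have "A $ 2 $ 1 = g $ 1 $ 1 + g $ 2 $ 1"
      by (simp add: A_def matrix_matrix_mult_def sum_2 transpose_def T_entries)
    moreover have "g $ 1 $ 1 + g $ 2 $ 1 \<notin> M"
      using ideal_diff[OF I(1) _ True, of "g $ 1 $ 1 + g $ 2 $ 1"] \<open>g $ 1 $ 1 \<notin> M\<close> by auto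
    moreover have "A \<in> carrier SL2" unfolding A_def by (rule mult_closed_SL2[OF transpose_T_car g])
    ultimately have "liftable (transpose (T (- 1)) ** A)" using lower_unit mult T' by simp
    moreover have "transpose (T (- 1)) ** A = g"
      by (simp add: A_def vec_eq_iff forall_2 matrix_matrix_mult_def sum_2 transpose_def T_entries)
    ultimately show ?thesis by simp
  qed
  then show thesis using that by (auto simp: liftable_def)
qed

text \<open>Places are added one at a time: a solution \<open>g\<close> for \<open>S\<close> is
  multiplied by a lift \<open>h\<close> of \<open>f M g\<inverse>\<close> from the place
  \<open>M\<close> that is trivial at all places of \<open>S\<close>.\<close>

lemma SL2_glue:
  fixes q :: "'a set" and f :: "'a set \<Rightarrow> 'a^2^2"
  assumes q: "ideal_of q" "q \<noteq> {0}"
    and S: "finite S" "\<And>M. M \<in> S \<Longrightarrow> maximal_ideal_of M \<and> q \<subseteq> M"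
    and f: "\<And>M. M \<in> S \<Longrightarrow> f M \<in> carrier SL2"
  shows "\<exists>g\<in>carrier SL2. \<forall>M\<in>S. mat_cong (local_part M q) g (f M)"
  using S f
proof (induction S rule: finite_induct)
  case empty
  show ?case using T_car by blast
next
  case (insert M S)
  then obtain g where g: "g \<in> carrier SL2" "\<And>N. N \<in> S \<Longrightarrow> mat_cong (local_part N q) g (f N)"
    by (metis insertI2)
  have M: "maximal_ideal_of M" "q \<subseteq> M" "f M \<in> carrier SL2" using insert.prems by auto
  have S: "maximal_ideal_of N \<and> q \<subseteq> N \<and> N \<noteq> M" if "N \<in> S" for N
    using insert.prems(1)[of N] insert.hyps that by auto
  have L: "ideal_of (local_part N q)" if "N \<in> insert M S" for N
    using ideal_local_part[OF maximal_ideal_prime q(1)] insert.prems(1)[OF that] by blast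
  define R where "R = (\<Inter>N\<in>S. local_part N q)"
  have R: "ideal_of R"
    unfolding ideal_iff R_def
    using ideal_zero[OF L] ideal_add[OF L] ideal_mult_left[OF L] by simp
  obtain e where e: "1 - e \<in> local_part M q" "\<And>N. N \<in> S \<Longrightarrow> e \<in> local_part N q"
    using local_idempotent[OF q M(1,2) insert.hyps(1) S] by blast
  define u where "u = f M ** inv\<^bsub>SL2\<^esub> g"
  have u: "u \<in> carrier SL2" unfolding u_def using M(3) g(1) by (intro mult_closed_SL2 inv_closed_SL2)
  have ug: "u ** g = f M"
    by (simp add: u_def inv_mult_SL2[OF g(1)] flip: matrix_mul_assoc)
  have "e \<in> R" using e(2) by (simp add: R_def)
  then obtain h where h: "h \<in> carrier SL2" "mat_cong (local_part M q) h u" "mat_cong R h (mat 1)"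
    using SL2_lift_local[OF q M(1,2) R e(1) _ u] by blast
  have "mat_cong (local_part N q) (h ** g) (f N)" if "N \<in> insert M S" for N
  proof (cases "N = M")
    case True
    then show ?thesis
      using mat_cong_mult[OF L[of M] h(2) mat_cong_refl[OF L[of M], of g]] ug by simp
  next
    case False
    then have N: "N \<in> S" using that by simp
    then have "mat_cong (local_part N q) h (mat 1)" using h(3) by (auto simp: mat_cong_def R_def)
    then show ?thesis using mat_cong_mult[OF L[OF that] _ g(2)[OF N]] by fastforce
  qed
  then show ?case using mult_closed_SL2[OF h(1) g(1)] by blast
qed

end

section \<open>Extremal amplitudes\<close>

lemma ideal_sum_eq_greatest:
  assumes I: "ideal_of I" "I \<in> \<A>" and le: "\<And>J. J \<in> \<A> \<Longrightarrow> J \<subseteq> I"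
  shows "ideal_sum \<A> = I"
proof
  show "ideal_sum \<A> \<subseteq> I"
    unfolding ideal_sum_def using le by (auto intro!: ideal_sum_closed[OF I(1)])
  show "I \<subseteq> ideal_sum \<A>"
  proof
    fix z assume z: "z \<in> I"
    have "z = (\<Sum>J\<in>{I}. (\<lambda>_. z) J)" by simp
    then show "z \<in> ideal_sum \<A>"
      unfolding ideal_sum_def using z I(2) by (intro CollectI exI[of _ "{I}"] exI[of _ "\<lambda>_. z"]) simp
  qed
qed

text \<open>The right-hand side has the shape of the condition in \<open>amplitude_at\<close>, taken
  at the inverse of \<open>g\<close>; this links the level to amplitudes.\<close>

lemma mem_conjugate_iff:
  assumes H: "subgroup H SL2" and g: "g \<in> carrier SL2" and t: "t \<in> carrier SL2"
  shows "t \<in> g <#\<^bsub>SL2\<^esub> H #>\<^bsub>SL2\<^esub> inv\<^bsub>SL2\<^esub> g \<longleftrightarrow>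
    inv\<^bsub>SL2\<^esub> g \<otimes>\<^bsub>SL2\<^esub> t \<otimes>\<^bsub>SL2\<^esub> inv\<^bsub>SL2\<^esub> (inv\<^bsub>SL2\<^esub> g) \<in> H"
proof -
  have Hc: "h \<in> carrier SL2" if "h \<in> H" for h by (rule subgroup.mem_carrier[OF H that])
  note gi = inv_mult_SL2[OF g]
  have cancel: "inv\<^bsub>SL2\<^esub> g ** (g ** A) = A" "g ** (inv\<^bsub>SL2\<^esub> g ** A) = A" for A
    by (simp_all add: matrix_mul_assoc gi)
  have "t = g ** h ** inv\<^bsub>SL2\<^esub> g \<longleftrightarrow> h = inv\<^bsub>SL2\<^esub> g ** t ** g" for h
    by (auto simp: cancel gi simp flip: matrix_mul_assoc)
  then show ?thesis
    by (auto simp: l_coset_def r_coset_def mult_SL2 group.inv_inv[OF SL2_group g])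
qed

section \<open>Amplitudes of a congruence subgroup\<close>

locale dedekind_congruence = dedekind ty for ty :: "'a::idom itself" +
  fixes H :: "('a^2^2) set" and q :: "'a set"
  assumes H: "subgroup H SL2" and q: "ideal_of q" "q \<noteq> {0}" and principal: "SL2_principal q \<subseteq> H"
begin

text \<open>The quotient \<open>B A\<inverse>\<close> lies in the principal congruence subgroup of
  \<open>q\<close>, so membership in \<open>H\<close> depends only on the class modulo
  \<open>q\<close>.\<close>

lemma mem_of_mat_cong:
  assumes "A \<in> H" "B \<in> carrier SL2" "mat_cong q B A"
  shows "B \<in> H"
proof -
  have A: "A \<in> carrier SL2" by (rule subgroup.mem_carrier[OF H assms(1)])
  have "mat_cong q (B ** inv\<^bsub>SL2\<^esub> A) (mat 1)"
    using mat_cong_mult[OF q(1) assms(3) mat_cong_refl[OF q(1)], of "inv\<^bsub>SL2\<^esub> A"]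
    by (simp add: inv_mult_SL2[OF A])
  then have "B ** inv\<^bsub>SL2\<^esub> A \<in> H"
    using principal mat_cong_SL2_principal mult_closed_SL2[OF assms(2) inv_closed_SL2[OF A]] by blast
  then have "B ** inv\<^bsub>SL2\<^esub> A ** A \<in> H"
    using subgroup.m_closed[OF H _ assms(1)] by (simp add: mult_SL2)
  then show ?thesis by (simp add: inv_mult_SL2[OF A] flip: matrix_mul_assoc)
qed

lemma conjugate_car: "g \<in> carrier SL2 \<Longrightarrow> g ** T x ** inv\<^bsub>SL2\<^esub> g \<in> carrier SL2"
  by (intro mult_closed_SL2 inv_closed_SL2 T_car)

lemma conjugate_cong_one:
  assumes "ideal_of I" "g \<in> carrier SL2" "x \<in> I"
  shows "mat_cong I (g ** T x ** inv\<^bsub>SL2\<^esub> g) (mat 1)"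
proof -
  have "mat_cong I (g ** T x ** inv\<^bsub>SL2\<^esub> g) (g ** T 0 ** inv\<^bsub>SL2\<^esub> g)"
    using assms by (intro mat_cong_mult mat_cong_refl mat_cong_T) auto
  then show ?thesis by (simp add: T_zero inv_mult_SL2[OF assms(2)])
qed

lemma ideal_amplitude: "g \<in> carrier SL2 \<Longrightarrow> ideal_of (amplitude_at H g)"
  using amplitude_at_greatest(1)[OF H] by blast

lemma amplitude_mem:
  "g \<in> carrier SL2 \<Longrightarrow> x \<in> amplitude_at H g \<Longrightarrow> g ** T x ** inv\<^bsub>SL2\<^esub> g \<in> H"
  using amplitude_at_greatest(1)[OF H, of g] by (simp add: mult_SL2)

lemma amplitude_greatest:
  "g \<in> carrier SL2 \<Longrightarrow> ideal_of I \<Longrightarrow> (\<And>x. x \<in> I \<Longrightarrow> g ** T x ** inv\<^bsub>SL2\<^esub> g \<in> H)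
    \<Longrightarrow> I \<subseteq> amplitude_at H g"
  using amplitude_at_greatest(2)[OF H, of g I] by (simp add: mult_SL2)

lemma congruence_ideal_subset_amplitude:
  assumes "g \<in> carrier SL2"
  shows "q \<subseteq> amplitude_at H g"
  using principal mat_cong_SL2_principal conjugate_car conjugate_cong_one[OF q(1)] assms
  by (intro amplitude_greatest q(1)) blast+

text \<open>At any other maximal ideal the local part of every amplitude is all of \<open>D\<close>,
  because amplitudes contain \<open>q\<close>.\<close>

definition places :: "'a set set" where
  "places = {M. maximal_ideal_of M \<and> q \<subseteq> M}"

lemma finite_places: "finite places"
  unfolding places_def by (rule finite_maximal_ideals_above[OF q])

lemma local_amplitude_mono:
  assumes M: "M \<in> places" and g: "g \<in> carrier SL2" "g' \<in> carrier SL2"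
    and cong: "mat_cong (local_part M q) g g'"
  shows "local_part M (amplitude_at H g) \<subseteq> local_part M (amplitude_at H g')"
proof -
  have M': "maximal_ideal_of M" "q \<subseteq> M" using M by (simp_all add: places_def)
  have prime: "prime_ideal_of M" by (rule maximal_ideal_prime[OF M'(1)])
  have L: "ideal_of (local_part N q)" if "N \<in> places" for N
    using that ideal_local_part[OF maximal_ideal_prime q(1)] by (auto simp: places_def)
  have others: "maximal_ideal_of N \<and> q \<subseteq> N \<and> N \<noteq> M" if "N \<in> places - {M}" for N
    using that by (simp add: places_def)
  obtain e where e: "1 - e \<in> local_part M q" "\<And>N. N \<in> places - {M} \<Longrightarrow> e \<in> local_part N q"
    using local_idempotent[OF q M' finite_Diff[OF finite_places] others] by blast
  have "e \<notin> M"
  proof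
    assume "e \<in> M"
    then have "(1 - e) + e \<in> M"
      using e(1) local_part_subset[OF prime M'(2)] M'(1)
      by (intro ideal_add) (auto simp: maximal_ideal_iff)
    then show False using M'(1) by (simp add: maximal_ideal_iff)
  qed
  \<comment> \<open>For \<open>x\<close> in \<open>J\<close> the conjugates of \<open>T x\<close> by
    \<open>g\<close> and \<open>g'\<close> agree modulo every local part of \<open>q\<close>: at
    \<open>M\<close> by \<open>cong\<close>, elsewhere because both are trivial. So they agree
    modulo \<open>q\<close>.\<close>
  define J where "J = amplitude_at H g \<inter> (\<Inter>N\<in>places - {M}. local_part N q)"
  have J: "ideal_of J"
    using ideal_amplitude[OF g(1)] L unfolding J_def by (simp add: ideal_iff)
  have "J \<subseteq> amplitude_at H g'"
  proof (rule amplitude_greatest[OF g(2) J])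
    fix x assume x: "x \<in> J"
    let ?A = "g ** T x ** inv\<^bsub>SL2\<^esub> g" and ?B = "g' ** T x ** inv\<^bsub>SL2\<^esub> g'"
    have "mat_cong (local_part N q) ?B ?A" if N: "N \<in> places" for N
    proof (cases "N = M")
      case True
      have "mat_cong (local_part M q) ?A ?B"
        by (intro mat_cong_mult mat_cong_inv mat_cong_refl cong L M g)
      then show ?thesis using mat_cong_sym[OF L[OF M]] True by simp
    next
      case False
      then have "x \<in> local_part N q" using N x by (simp add: J_def)
      then show ?thesis
        using conjugate_cong_one[OF L[OF N]] g mat_cong_sym[OF L[OF N]] mat_cong_trans[OF L[OF N]]
        by blast
    qed
    then have "mat_cong q ?B ?A"
      unfolding mat_cong_def by (intro allI in_all_local_parts[OF q(1)]) (simp add: places_def)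
    moreover have "?A \<in> H" using amplitude_mem[OF g(1)] x by (simp add: J_def)
    ultimately show "?B \<in> H" using mem_of_mat_cong conjugate_car[OF g(2)] by blast
  qed
  \<comment> \<open>Multiplication by \<open>e\<close> carries the amplitude at \<open>g\<close>
    into \<open>J\<close>; since \<open>e\<close> is outside \<open>M\<close>, this is invisible in
    local parts at \<open>M\<close>.\<close>
  moreover have "e * x \<in> J" if "x \<in> amplitude_at H g" for x
    using ideal_mult_left[OF ideal_amplitude[OF g(1)] that] ideal_mult_right[OF L] e(2)
    by (simp add: J_def)
  ultimately have e': "e * x \<in> amplitude_at H g'" if "x \<in> amplitude_at H g" for x
    using that by blast
  show ?thesis
  proof
    fix z assume "z \<in> local_part M (amplitude_at H g)"
    then obtain s where s: "s \<notin> M" "s * z \<in> amplitude_at H g" by (auto simp: local_part_def)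
    then have "s * z \<in> local_part M (amplitude_at H g')"
      using e' \<open>e \<notin> M\<close> unfolding local_part_def by blast
    then show "z \<in> local_part M (amplitude_at H g')" by (rule local_part_cancel[OF prime s(1)])
  qed
qed

lemma local_amplitude_cong:
  assumes "M \<in> places" "g \<in> carrier SL2" "g' \<in> carrier SL2" "mat_cong (local_part M q) g g'"
  shows "local_part M (amplitude_at H g) = local_part M (amplitude_at H g')"
proof -
  have "ideal_of (local_part M q)"
    using assms(1) ideal_local_part[OF maximal_ideal_prime q(1)] by (auto simp: places_def)
  then show ?thesis using local_amplitude_mono mat_cong_sym assms by (meson subset_antisym)
qed

text \<open>Inclusion is local, and every maximal ideal above the amplitude at \<open>g'\<close> is
  above \<open>q\<close>, hence one of the finitely many places.\<close>

lemma amplitude_subsetI: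
  assumes "g \<in> carrier SL2" "g' \<in> carrier SL2"
    and "\<And>M. M \<in> places \<Longrightarrow> local_part M (amplitude_at H g) \<subseteq> local_part M (amplitude_at H g')"
  shows "amplitude_at H g \<subseteq> amplitude_at H g'"
proof
  fix x assume x: "x \<in> amplitude_at H g"
  show "x \<in> amplitude_at H g'"
  proof (rule in_all_local_parts[OF ideal_amplitude[OF assms(2)]])
    fix M assume M: "maximal_ideal_of M" "amplitude_at H g' \<subseteq> M"
    then have "M \<in> places" using congruence_ideal_subset_amplitude[OF assms(2)] by (auto simp: places_def)
    moreover have "x \<in> local_part M (amplitude_at H g)"
      using subset_local_part x M by (auto simp: maximal_ideal_iff)
    ultimately show "x \<in> local_part M (amplitude_at H g')" using assms(3) by blast
  qed
qed

lemma glue_local_amplitudes: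
  assumes f: "\<And>M. M \<in> places \<Longrightarrow> f M \<in> carrier SL2"
  obtains g where "g \<in> carrier SL2"
    "\<And>M. M \<in> places \<Longrightarrow> local_part M (amplitude_at H g) = local_part M (amplitude_at H (f M))"
proof -
  have place: "maximal_ideal_of M \<and> q \<subseteq> M" if "M \<in> places" for M
    using that by (simp add: places_def)
  obtain g where "g \<in> carrier SL2" "\<forall>M\<in>places. mat_cong (local_part M q) g (f M)"
    using SL2_glue[where f = f, OF q finite_places place f] by blast
  then show thesis using that local_amplitude_cong f by meson
qed

lemma extremal_local_amplitudes:
  assumes "M \<in> places"
  shows "\<exists>g\<in>carrier SL2. \<forall>g'\<in>carrier SL2.
      local_part M (amplitude_at H g) \<subseteq> local_part M (amplitude_at H g')"
    and "\<exists>g\<in>carrier SL2. \<forall>g'\<in>carrier SL2.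
      local_part M (amplitude_at H g') \<subseteq> local_part M (amplitude_at H g)"
proof -
  have ne: "amplitudes H \<noteq> {}" using T_car by (auto simp: amplitudes_def)
  have "I \<in> amplitudes H \<Longrightarrow> ideal_of I \<and> q \<subseteq> I" for I
    using ideal_amplitude congruence_ideal_subset_amplitude by (auto simp: amplitudes_def)
  note ext = extremal_local_parts[OF q _ _ ne this, of M]
  show "\<exists>g\<in>carrier SL2. \<forall>g'\<in>carrier SL2.
      local_part M (amplitude_at H g) \<subseteq> local_part M (amplitude_at H g')"
    using ext(1) assms by (simp add: places_def amplitudes_def)
  show "\<exists>g\<in>carrier SL2. \<forall>g'\<in>carrier SL2.
      local_part M (amplitude_at H g') \<subseteq> local_part M (amplitude_at H g)"
    using ext(2) assms by (simp add: places_def amplitudes_def)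
qed

text \<open>A matrix with least local part is chosen separately at each place; the glued matrix has
  all these local parts at once.\<close>

lemma least_amplitude:
  obtains g where "g \<in> carrier SL2" "\<And>g'. g' \<in> carrier SL2 \<Longrightarrow> amplitude_at H g \<subseteq> amplitude_at H g'"
proof -
  obtain f where f: "\<And>M. M \<in> places \<Longrightarrow> f M \<in> carrier SL2"
    "\<And>M g'. M \<in> places \<Longrightarrow> g' \<in> carrier SL2 \<Longrightarrow>
      local_part M (amplitude_at H (f M)) \<subseteq> local_part M (amplitude_at H g')"
    using extremal_local_amplitudes(1) by metis
  obtain g where "g \<in> carrier SL2"
    "\<And>M. M \<in> places \<Longrightarrow> local_part M (amplitude_at H g) = local_part M (amplitude_at H (f M))"
    using glue_local_amplitudes f(1) by blast
  then show thesis using f(2) that amplitude_subsetI by simp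
qed

lemma greatest_amplitude:
  obtains g where "g \<in> carrier SL2" "\<And>g'. g' \<in> carrier SL2 \<Longrightarrow> amplitude_at H g' \<subseteq> amplitude_at H g"
proof -
  obtain f where f: "\<And>M. M \<in> places \<Longrightarrow> f M \<in> carrier SL2"
    "\<And>M g'. M \<in> places \<Longrightarrow> g' \<in> carrier SL2 \<Longrightarrow>
      local_part M (amplitude_at H g') \<subseteq> local_part M (amplitude_at H (f M))"
    using extremal_local_amplitudes(2) by metis
  obtain g where "g \<in> carrier SL2"
    "\<And>M. M \<in> places \<Longrightarrow> local_part M (amplitude_at H g) = local_part M (amplitude_at H (f M))"
    using glue_local_amplitudes f(1) by blast
  then show thesis using f(2) that amplitude_subsetI by simp
qed

text \<open>As \<open>k\<close> runs through the group, so does its inverse. Hence the level is the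
  largest ideal contained in all amplitudes, which is the least amplitude.\<close>

lemma level_eq_least_amplitude:
  assumes g: "g \<in> carrier SL2" "\<And>g'. g' \<in> carrier SL2 \<Longrightarrow> amplitude_at H g \<subseteq> amplitude_at H g'"
  shows "level H = amplitude_at H g"
  unfolding level_def
proof (rule Greatest_equality)
  have conj: "T r \<in> k <#\<^bsub>SL2\<^esub> H #>\<^bsub>SL2\<^esub> inv\<^bsub>SL2\<^esub> k \<longleftrightarrow>
      inv\<^bsub>SL2\<^esub> k ** T r ** inv\<^bsub>SL2\<^esub> (inv\<^bsub>SL2\<^esub> k) \<in> H" if "k \<in> carrier SL2" for k r
    using mem_conjugate_iff[OF H that T_car] by (simp add: mult_SL2)
  show "ideal_of (amplitude_at H g) \<and> (\<forall>r\<in>amplitude_at H g. \<forall>k\<in>carrier SL2.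
      T r \<in> k <#\<^bsub>SL2\<^esub> H #>\<^bsub>SL2\<^esub> inv\<^bsub>SL2\<^esub> k)"
    using ideal_amplitude[OF g(1)] g(2)[OF inv_closed_SL2] amplitude_mem[OF inv_closed_SL2]
    by (auto simp: conj)
  show "I \<subseteq> amplitude_at H g" if I: "ideal_of I \<and> (\<forall>r\<in>I. \<forall>k\<in>carrier SL2.
      T r \<in> k <#\<^bsub>SL2\<^esub> H #>\<^bsub>SL2\<^esub> inv\<^bsub>SL2\<^esub> k)" for I
  proof (rule amplitude_greatest[OF g(1)])
    show "ideal_of I" using I by simp
    fix x assume "x \<in> I"
    then have "T x \<in> inv\<^bsub>SL2\<^esub> g <#\<^bsub>SL2\<^esub> H #>\<^bsub>SL2\<^esub> inv\<^bsub>SL2\<^esub> (inv\<^bsub>SL2\<^esub> g)"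
      using I inv_closed_SL2[OF g(1)] by blast
    then show "g ** T x ** inv\<^bsub>SL2\<^esub> g \<in> H"
      using conj[OF inv_closed_SL2[OF g(1)]] by (simp add: group.inv_inv[OF SL2_group g(1)])
  qed
qed

lemma cusp_of_infinity:
  assumes g: "g \<in> carrier SL2"
  obtains C where "C \<in> cusps H" "cusp_amplitude H C = amplitude_at H g"
proof -
  \<comment> \<open>The \<open>H\<close>-orbit of the point \<open>g(\<infinity>)\<close>.\<close>
  define C where "C = orbit (SL2\<lparr>carrier := H\<rparr>) lin_frac (lin_frac g Infty)"
  have C: "C \<in> cusps H"
    unfolding cusps_def orbits_def C_def using g by (auto simp: orbit_def simp del: lin_frac.simps)
  have one: "mat 1 \<in> H" using subgroup.one_closed[OF H] by (simp add: one_SL2)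
  \<comment> \<open>Compatibility of the action with the product \<open>mat 1 ** g = g\<close> shows
    that the identity fixes this point, which therefore lies in its own orbit.\<close>
  have "lin_frac (mat 1) (lin_frac g Infty) = lin_frac g Infty"
    using lin_frac_mult[of "mat 1" g Infty] g subgroup.mem_carrier[OF H one]
    by (simp add: mult_SL2 del: lin_frac.simps)
  then have "lin_frac g Infty \<in> C"
    using one unfolding C_def orbit_def by (force simp del: lin_frac.simps)
  then show thesis using that C cusp_amplitude_eq[OF H C g] by blast
qed

end

theorem theoremA:
  fixes H :: "('a::idom^2^2) set"
  assumes "dedekind_domain TYPE('a)"
    and "subgroup H SL2"
    and "congruence_subgroup H"
  shows "c_min H \<in> amplitudes H \<and> c_max H \<in> amplitudes H \<and>
         (\<exists>C\<in>cusps H. cusp_amplitude H C = level H)"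
proof -
  obtain q where "ideal_of q" "q \<noteq> {0}" "SL2_principal q \<subseteq> H"
    using assms(3) by (auto simp: congruence_subgroup_def)
  then interpret dedekind_congruence "TYPE('a)" H q
    using assms by (intro dedekind_congruence.intro dedekind.intro dedekind_congruence_axioms.intro)
  obtain g where g: "g \<in> carrier SL2" "\<And>g'. g' \<in> carrier SL2 \<Longrightarrow> amplitude_at H g \<subseteq> amplitude_at H g'"
    using least_amplitude by blast
  have "c_min H = amplitude_at H g"
    using g unfolding c_min_def amplitudes_def by blast
  moreover obtain h where h: "h \<in> carrier SL2"
    "\<And>g'. g' \<in> carrier SL2 \<Longrightarrow> amplitude_at H g' \<subseteq> amplitude_at H h"
    using greatest_amplitude by blast
  have "c_max H = amplitude_at H h"
    unfolding c_max_def using h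
    by (intro ideal_sum_eq_greatest ideal_amplitude) (auto simp: amplitudes_def)
  moreover obtain C where "C \<in> cusps H" "cusp_amplitude H C = amplitude_at H g"
    using cusp_of_infinity[OF g(1)] .
  ultimately show ?thesis
    using g h level_eq_least_amplitude[OF g] by (auto simp: amplitudes_def)
qed

end
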